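(* Let $\eta\in[0,0.5)$ and $\delta\in[0,1]$ be constants, and let $\Pi$ be a property of $n$-bit strings that can be tested using $Q(n,\epsilon)$ queries. Then the property $\mathcal{D}^{{\rm per},\Pi}_{\eta,\delta}=\bigcup_{x^*\in\Pi}\mathcal{D}^{\rm per}_{\eta,\delta}(x^* )$ can be tested in the DoHO model using $\mathrm{poly}(1/\epsilon)+\widetilde{O}(Q(n,\epsilon/2))$ queries.
   Context: For $x^*\in\{0,1\}^n$, $\mathcal{D}^{\rm per}_{\eta,\delta}(x^* )$ is the set of distributions $X$ over $\{0,1\}^n$ such that (1) $\Pr[X_i\neq x^*_i]\le\eta$ for every $i\in[n]$, and (2) $\Pr[|\{i\in[n]:X_i\neq x^*_i\}|\le\delta n]=1$. For $x,y\in\{0,1\}^n$ let $\Delta_H(x,y)=\frac1n|\{i:x_i\neq y_i\}|$. A tester for the string property $\Pi$ with query complexity $Q$ is an oracle machine that on input $n,\epsilon$ and oracle access to $x\in\{0,1\}^n$ makes at most $Q(n,\epsilon)$ queries, accepts with probability at least $2/3$ if $x\in\Pi$ and rejects with probability at least $2/3$ if $\Delta_H(x,z)>\epsilon$ for all $z\in\Pi$. The distance between distributions $P,Q'$ over $\{0,1\}^n$ is $\min\sum_{x,y}w_{x,y}\Delta_H(x,y)$ over nonnegative $w_{x,y}$ with $\sum_y w_{x,y}=P(x)$, $\sum_x w_{x,y}=Q'(y)$; $\epsilon$-far from a set means distance greater than $\epsilon$ to every member. A tester in the DoHO model for a set $\mathcal{E}$ of distributions over $\{0,1\}^n$ gets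 $n,\epsilon$ and oracle access to independent samples of an unknown distribution $P$, may query individual bits of samples, and must accept with probability at least $2/3$ if $P\in\mathcal{E}$ and reject with probability at least $2/3$ if $P$ is $\epsilon$-far from $\mathcal{E}$; its query complexity is the total number of bit queries. *)

theory Defs
  imports
    "HOL-Probability.Probability"
    "HOL-Probability.Product_PMF"
    "HOL-Computational_Algebra.Polynomial"
begin

definition bitstrings :: "nat \<Rightarrow> bool list set" where
  "bitstrings n = {x. length x = n}"

definition hamming_dist :: "nat \<Rightarrow> bool list \<Rightarrow> bool list \<Rightarrow> real" where
  "hamming_dist n x y = real (card {i. i < n \<and> x ! i \<noteq> y ! i}) / real n"

definition distributions :: "nat \<Rightarrow> bool list pmf set" where
  "distributions n = {P. set_pmf P \<subseteq> bitstrings n}"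

definition transport_plan ::
  "nat \<Rightarrow> bool list pmf \<Rightarrow> bool list pmf \<Rightarrow> (bool list \<Rightarrow> bool list \<Rightarrow> real) \<Rightarrow> bool" where
  "transport_plan n P P' w \<longleftrightarrow>
     (\<forall>x \<in> bitstrings n. \<forall>y \<in> bitstrings n. 0 \<le> w x y) \<and>
     (\<forall>x \<in> bitstrings n. (\<Sum>y \<in> bitstrings n. w x y) = pmf P x) \<and>
     (\<forall>y \<in> bitstrings n. (\<Sum>x \<in> bitstrings n. w x y) = pmf P' y)"

(* For P, P' in distributions n the transport plans, restricted to n-bit strings, form a
   nonempty compact set, so this infimum is a minimum. *)
definition emd :: "nat \<Rightarrow> bool list pmf \<Rightarrow> bool list pmf \<Rightarrow> real" where
  "emd n P P' =
     Inf {(\<Sum>x \<in> bitstrings n. \<Sum>y \<in> bitstrings n. w x y * hamming_dist n x y) | w.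
            transport_plan n P P' w}"

(* A deterministic adaptive query algorithm: "Query q t0 t1" asks for the bit named q and
   continues as t0 if the answer is 0 (False) and as t1 if it is 1 (True). A randomized
   algorithm is a probability distribution over such trees (all coins are tossed first). *)
datatype (queries: 'q) query_tree =
    Verdict bool
  | Query 'q "'q query_tree" "'q query_tree"

fun run :: "'q query_tree \<Rightarrow> ('q \<Rightarrow> bool) \<Rightarrow> bool" where
  "run (Verdict b) f = b"
| "run (Query q t0 t1) f = (if f q then run t1 f else run t0 f)"

fun query_count :: "'q query_tree \<Rightarrow> nat" where
  "query_count (Verdict b) = 0"
| "query_count (Query q t0 t1) = Suc (max (query_count t0) (query_count t1))"

definition string_verdict :: "nat query_tree pmf \<Rightarrow> bool list \<Rightarrow> bool pmf" where
  "string_verdict T x = map_pmf (\<lambda>t. run t (\<lambda>i. x ! i)) T"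

definition string_tester ::
  "(nat \<Rightarrow> bool list set) \<Rightarrow> (nat \<Rightarrow> real \<Rightarrow> nat) \<Rightarrow> (nat \<Rightarrow> real \<Rightarrow> nat query_tree pmf) \<Rightarrow> bool"
where
  "string_tester S Q T \<longleftrightarrow>
     (\<forall>n > 0. \<forall>\<epsilon> > 0.
        (\<forall>t \<in> set_pmf (T n \<epsilon>). queries t \<subseteq> {..<n} \<and> query_count t \<le> Q n \<epsilon>) \<and>
        (\<forall>x \<in> bitstrings n.
           (x \<in> S n \<longrightarrow> pmf (string_verdict (T n \<epsilon>) x) True \<ge> 2/3) \<and>
           ((\<forall>z \<in> S n. hamming_dist n x z > \<epsilon>) \<longrightarrow>
              pmf (string_verdict (T n \<epsilon>) x) False \<ge> 2/3)))"

definition string_testable :: "(nat \<Rightarrow> bool list set) \<Rightarrow> (nat \<Rightarrow> real \<Rightarrow> nat) \<Rightarrow> bool" where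
  "string_testable S Q \<longleftrightarrow> (\<exists>T. string_tester S Q T)"

(* The query (j, i) asks for bit i of the j-th sample. The samples are independent and
   distributed according to P; since t only looks at samples with index in fst ` queries t,
   only these finitely many are drawn (others are set to the irrelevant default []). *)
definition doho_verdict :: "(nat \<times> nat) query_tree pmf \<Rightarrow> bool list pmf \<Rightarrow> bool pmf" where
  "doho_verdict T P =
     bind_pmf T (\<lambda>t.
       map_pmf (\<lambda>s. run t (\<lambda>(j, i). s j ! i)) (Pi_pmf (fst ` queries t) [] (\<lambda>_. P)))"

definition doho_tester ::
  "(nat \<Rightarrow> bool list pmf set) \<Rightarrow> (nat \<Rightarrow> real \<Rightarrow> nat) \<Rightarrow>
   (nat \<Rightarrow> real \<Rightarrow> (nat \<times> nat) query_tree pmf) \<Rightarrow> bool"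
where
  "doho_tester \<E> q T \<longleftrightarrow>
     (\<forall>n > 0. \<forall>\<epsilon> > 0.
        (\<forall>t \<in> set_pmf (T n \<epsilon>). queries t \<subseteq> UNIV \<times> {..<n} \<and> query_count t \<le> q n \<epsilon>) \<and>
        (\<forall>P \<in> distributions n.
           (P \<in> \<E> n \<longrightarrow> pmf (doho_verdict (T n \<epsilon>) P) True \<ge> 2/3) \<and>
           ((\<forall>P' \<in> \<E> n. emd n P P' > \<epsilon>) \<longrightarrow>
              pmf (doho_verdict (T n \<epsilon>) P) False \<ge> 2/3)))"

definition doho_testable :: "(nat \<Rightarrow> bool list pmf set) \<Rightarrow> (nat \<Rightarrow> real \<Rightarrow> nat) \<Rightarrow> bool" where
  "doho_testable \<E> q \<longleftrightarrow> (\<exists>T. doho_tester \<E> q T)"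

definition D_per :: "nat \<Rightarrow> real \<Rightarrow> real \<Rightarrow> bool list \<Rightarrow> bool list pmf set" where
  "D_per n \<eta> \<delta> x' =
     {P \<in> distributions n.
        (\<forall>i < n. measure_pmf.prob P {x. x ! i \<noteq> x' ! i} \<le> \<eta>) \<and>
        measure_pmf.prob P {x. real (card {i. i < n \<and> x ! i \<noteq> x' ! i}) \<le> \<delta> * real n} = 1}"

definition D_per_prop ::
  "(nat \<Rightarrow> bool list set) \<Rightarrow> real \<Rightarrow> real \<Rightarrow> nat \<Rightarrow> bool list pmf set" where
  "D_per_prop S \<eta> \<delta> n = (\<Union>x' \<in> S n. D_per n \<eta> \<delta> x')"

end

theory Submission
  imports Defs "HOL-Probability.Hoeffding"
begin

text \<open>
  Let \<open>x\<close> be the string of majority bits of \<open>P\<close>. By an explicit coupling,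
  the distance of \<open>P\<close> from the perturbations of \<open>z\<close> is at most the sum of
  the distance between \<open>x\<close> and \<open>z\<close>, the average excess of
  \<open>Pr[X\<^sub>i \<noteq> x\<^sub>i]\<close> over \<open>\<eta>\<close>, and the expected excess of
  the distance between \<open>X\<close> and \<open>x\<close> over \<open>\<delta>\<close>
  (rounded down to a multiple of \<open>1/n\<close>). So if \<open>P\<close> is \<open>\<epsilon>\<close>-far
  from the property, then \<open>x\<close> is \<open>\<epsilon>/2\<close>-far from \<open>\<Pi>\<close>, or one of the
  two excesses exceeds \<open>\<epsilon>/4\<close>. The first case is detected by the string tester, whose queries are answered by
  a vote among \<open>O(log Q)\<close> samples. The other two are detected by reading
  \<open>poly(1/\<epsilon>)\<close> samples in \<open>poly(1/\<epsilon>)\<close> random positions. All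
  parts share the same samples and positions: every step of the analysis is a union bound, so no independence between
  the parts is needed.
\<close>

section \<open>Probability bounds\<close>

text \<open>Condition on the first component and average. Later estimates can thus freeze one source
  of randomness and use only the other.\<close>

lemma prob_pair_pmf_le:
  assumes "\<And>a. a \<in> set_pmf A \<Longrightarrow> measure_pmf.prob B {b. R a b} \<le> c"
  shows "measure_pmf.prob (pair_pmf A B) {x. R (fst x) (snd x)} \<le> c"
proof -
  have c: "c \<ge> 0"
    using assms set_pmf_not_empty[of A] by (meson ex_in_conv measure_nonneg order_trans)
  have "emeasure (pair_pmf A B) {x. R (fst x) (snd x)}
      = (\<integral>\<^sup>+x. indicator {x. R (fst x) (snd x)} x \<partial>pair_pmf A B)"
    by simp
  also have "\<dots> = (\<integral>\<^sup>+a. \<integral>\<^sup>+b. indicator {b. R a b} b \<partial>B \<partial>A)"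
    by (subst nn_integral_pair_pmf') (simp add: indicator_def mem_Collect_eq cong: nn_integral_cong del: nn_integral_indicator)
  also have "\<dots> = (\<integral>\<^sup>+a. emeasure B {b. R a b} \<partial>A)"
    by (intro nn_integral_cong, subst nn_integral_indicator) auto
  also have "\<dots> \<le> (\<integral>\<^sup>+a. ennreal c \<partial>A)"
    by (intro nn_integral_mono_AE AE_pmfI)
      (auto simp: measure_pmf.emeasure_eq_measure intro!: ennreal_leI assms)
  also have "\<dots> = ennreal c"
    by simp
  finally show ?thesis
    using c by (simp add: measure_pmf.emeasure_eq_measure)
qed

lemma prob_pair_pmf_le':
  assumes "\<And>b. b \<in> set_pmf B \<Longrightarrow> measure_pmf.prob A {a. R a b} \<le> c"
  shows "measure_pmf.prob (pair_pmf A B) {x. R (fst x) (snd x)} \<le> c"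
  by (subst pair_commute_pmf)
    (use prob_pair_pmf_le[of B A "\<lambda>b a. R a b", OF assms] in \<open>simp add: vimage_def case_prod_beta\<close>)

lemma prob_mono_on_support:
  assumes "\<And>x. x \<in> set_pmf p \<Longrightarrow> P x \<Longrightarrow> Q x"
  shows "measure_pmf.prob p {x. P x} \<le> measure_pmf.prob p {x. Q x}"
  by (rule measure_pmf.finite_measure_mono_AE) (auto simp: AE_measure_pmf_iff assms)

lemma prob_disj_le:
  "measure_pmf.prob p {x. P x \<or> Q x} \<le> measure_pmf.prob p {x. P x} + measure_pmf.prob p {x. Q x}"
  using measure_Un_le[of "{x. P x}" "measure_pmf p" "{x. Q x}"] by (simp add: Collect_disj_eq)

lemma prob_bex_le:
  fixes c :: real
  assumes "finite I" and "\<And>i. i \<in> I \<Longrightarrow> measure_pmf.prob p {x. P i x} \<le> c"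
  shows "measure_pmf.prob p {x. \<exists>i\<in>I. P i x} \<le> card I * c"
proof -
  have "measure_pmf.prob p {x. \<exists>i\<in>I. P i x} = measure_pmf.prob p (\<Union>i\<in>I. {x. P i x})"
    by (rule arg_cong[where f = "measure _"]) auto
  also have "\<dots> \<le> (\<Sum>i\<in>I. measure_pmf.prob p {x. P i x})"
    by (rule measure_pmf.finite_measure_subadditive_finite) (use assms in auto)
  also have "\<dots> \<le> card I * c"
    using sum_bounded_above[of I _ c] assms(2) by simp
  finally show ?thesis .
qed

lemma prob_Not: "measure_pmf.prob p {x. \<not> P x} = 1 - measure_pmf.prob p {x. P x}"
  using measure_pmf.prob_compl[of "{x. P x}" p] by (simp add: Compl_eq_Diff_UNIV[symmetric] Collect_neg_eq)

text \<open>A reverse Markov inequality, from the pointwise bound of \<open>f\<close> by the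
  indicator of \<open>c \<le> f\<close> plus \<open>c\<close>. It turns a large average excess into
  a non-negligible proportion of bad positions or samples.\<close>

lemma expectation_le_prob_ge:
  fixes f :: "'a \<Rightarrow> real"
  assumes "\<And>x. x \<in> set_pmf p \<Longrightarrow> 0 \<le> f x" and "\<And>x. x \<in> set_pmf p \<Longrightarrow> f x \<le> 1" and "0 \<le> c"
  shows "measure_pmf.expectation p f \<le> measure_pmf.prob p {x. c \<le> f x} + c"
proof -
  have int: "integrable (measure_pmf p) f"
    by (rule measure_pmf.integrable_const_bound[where B = 1]) (use assms in \<open>auto simp: AE_measure_pmf_iff\<close>)
  have "measure_pmf.expectation p f \<le> measure_pmf.expectation p (\<lambda>x. indicator {x. c \<le> f x} x + c)"
  proof (intro integral_mono_AE int)
    show "integrable (measure_pmf p) (\<lambda>x. indicator {x. c \<le> f x} x + c)"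
      by (rule measure_pmf.integrable_const_bound[where B = "1 + c"])
        (use assms(3) in \<open>auto simp: indicator_def\<close>)
    have "f x \<le> indicator {x. c \<le> f x} x + c" if "x \<in> set_pmf p" for x
      using assms(2)[OF that] assms(3) by (auto simp: indicator_def)
    then show "AE x in p. f x \<le> indicator {x. c \<le> f x} x + c"
      by (simp add: AE_measure_pmf_iff)
  qed
  also have "\<dots> = measure_pmf.prob p {x. c \<le> f x} + c"
    by (subst Bochner_Integration.integral_add)
      (auto intro!: measure_pmf.integrable_const_bound[where B = 1] simp del: indicator_simps)
  finally show ?thesis .
qed

section \<open>Hoeffding bounds for independent samples\<close>

lemma Pi_pmf_count_eq_binomial:
  fixes m N :: nat
  assumes "m \<le> N"
  shows "map_pmf (\<lambda>f. card {j. j < m \<and> f j \<in> B}) (Pi_pmf {..<N} d (\<lambda>_. p))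
    = binomial_pmf m (measure_pmf.prob p B)"
proof -
  have b: "map_pmf (\<lambda>x. x \<in> B) p = bernoulli_pmf (measure_pmf.prob p B)"
    by (rule pmf_eqI, case_tac i)
      (auto simp: pmf_map vimage_def prob_Not[of p "\<lambda>x. x \<in> B", simplified])
  have eq: "{x \<in> {..<m}. (\<lambda>x. x \<in> B) (if x < m then f x else d)} = {j. j < m \<and> f j \<in> B}" for f
    by auto
  have "binomial_pmf m (measure_pmf.prob p B)
      = map_pmf (\<lambda>f. card {x \<in> {..<m}. f x})
          (Pi_pmf {..<m} (d \<in> B) (\<lambda>_. map_pmf (\<lambda>x. x \<in> B) p))"
    unfolding b by (rule binomial_pmf_altdef') auto
  also have "\<dots> = map_pmf (\<lambda>f. card {x \<in> {..<m}. f x})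
      (map_pmf (\<lambda>h. (\<lambda>x. x \<in> B) \<circ> h) (Pi_pmf {..<m} d (\<lambda>_. p)))"
    by (subst Pi_pmf_map) auto
  also have "Pi_pmf {..<m} d (\<lambda>_. p)
      = map_pmf (\<lambda>f x. if x \<in> {..<m} then f x else d) (Pi_pmf {..<N} d (\<lambda>_. p))"
    by (rule Pi_pmf_subset) (use assms in auto)
  finally show ?thesis
    by (simp add: pmf.map_comp o_def eq cong: conj_cong)
qed

text \<open>Hoeffding's lower tail for a binomial count. With \<open>\<theta> = 0\<close> it bounds
  the probability of missing \<open>B\<close> in all \<open>m\<close> draws. Counting only the first
  \<open>m\<close> of \<open>N\<close> coordinates lets subtests of different sample sizes share one
  batch.\<close>

lemma Pi_pmf_count_le:
  fixes m N :: nat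
  assumes "m \<le> N" "0 \<le> t" "\<theta> + t \<le> measure_pmf.prob p B"
  shows "measure_pmf.prob (Pi_pmf {..<N} d (\<lambda>_. p)) {f. real (card {j. j < m \<and> f j \<in> B}) \<le> \<theta> * m}
    \<le> exp (- (2 * t\<^sup>2 * m))"
proof (cases "m = 0")
  case False
  define q where "q = measure_pmf.prob p B"
  interpret binomial_distribution m q
    by unfold_locales (simp add: q_def)
  have "measure_pmf.prob (Pi_pmf {..<N} d (\<lambda>_. p)) {f. real (card {j. j < m \<and> f j \<in> B}) \<le> \<theta> * m}
      = measure_pmf.prob (binomial_pmf m q) {k. real k \<le> \<theta> * m}"
    unfolding q_def
    by (subst Pi_pmf_count_eq_binomial[OF assms(1), where d = d, symmetric]) (simp add: vimage_def)
  also have "\<dots> \<le> measure_pmf.prob (binomial_pmf m q) {k. real k / m \<le> q - t}"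
  proof (rule measure_pmf.finite_measure_mono)
    have "\<theta> * m \<le> (q - t) * m"
      using assms by (intro mult_right_mono) (auto simp: q_def)
    then show "{k. real k \<le> \<theta> * m} \<subseteq> {k. real k / m \<le> q - t}"
      using False by (auto simp: field_simps)
  qed simp
  also have "\<dots> \<le> exp (-2 * m * t\<^sup>2)"
    by (rule prob_le') (use False assms in auto)
  finally show ?thesis
    by (simp add: mult_ac)
qed simp

text \<open>The upper tail for \<open>B\<close> is the lower tail for its complement, with threshold
  \<open>1 - \<theta>\<close>.\<close>

lemma Pi_pmf_count_gt:
  fixes m N :: nat
  assumes "m \<le> N" "0 \<le> t" "measure_pmf.prob p B \<le> \<theta> - t"
  shows "measure_pmf.prob (Pi_pmf {..<N} d (\<lambda>_. p)) {f. \<not> real (card {j. j < m \<and> f j \<in> B}) \<le> \<theta> * m}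
    \<le> exp (- (2 * t\<^sup>2 * m))"
proof -
  have compl: "real (card {j. j < m \<and> f j \<in> B}) = m - real (card {j. j < m \<and> f j \<in> - B})" for f
  proof -
    have "{..<m} - {j. j < m \<and> f j \<in> - B} = {j. j < m \<and> f j \<in> B}"
      by auto
    moreover have "{j. j < m \<and> f j \<in> - B} \<subseteq> {..<m}"
      by auto
    ultimately show ?thesis
      using card_Diff_subset[of "{j. j < m \<and> f j \<in> - B}" "{..<m}"]
        card_mono[of "{..<m}" "{j. j < m \<and> f j \<in> - B}"]
      by (simp add: of_nat_diff)
  qed
  have "real (card {j. j < m \<and> f j \<in> - B}) \<le> (1 - \<theta>) * m"
    if "\<not> real (card {j. j < m \<and> f j \<in> B}) \<le> \<theta> * m" for f
    using that compl[of f] by (simp add: left_diff_distrib)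
  then have "measure_pmf.prob (Pi_pmf {..<N} d (\<lambda>_. p)) {f. \<not> real (card {j. j < m \<and> f j \<in> B}) \<le> \<theta> * m}
      \<le> measure_pmf.prob (Pi_pmf {..<N} d (\<lambda>_. p)) {f. real (card {j. j < m \<and> f j \<in> - B}) \<le> (1 - \<theta>) * m}"
    by (intro prob_mono_on_support)
  also have "\<dots> \<le> exp (- (2 * t\<^sup>2 * m))"
    by (rule Pi_pmf_count_le)
      (use assms measure_pmf.prob_compl[of B p] in \<open>simp_all flip: Compl_eq_Diff_UNIV\<close>)
  finally show ?thesis .
qed

lemma prob_majority_of_three:
  assumes "measure_pmf.prob T {t. \<not> P t} \<le> 1/3"
  shows "measure_pmf.prob (pair_pmf T (pair_pmf T T))
    {(t1, t2, t3). \<not> (P t1 \<and> P t2 \<or> P t1 \<and> P t3 \<or> P t2 \<and> P t3)} \<le> 7/27"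
proof -
  define b where "b = map_pmf P T"
  define q where "q = pmf b False"
  have q: "0 \<le> q" "q \<le> 1/3" and t: "pmf b True = 1 - q"
    using assms by (auto simp: q_def b_def pmf_map vimage_def prob_Not[of T P, simplified])
  \<comment> \<open>The outcomes with at most one success, that is, those where the majority
    fails.\<close>
  let ?X = "{(False, False, False), (True, False, False), (False, True, False), (False, False, True)}"
  have "pair_pmf b (pair_pmf b b) = map_pmf (\<lambda>(t1, t2, t3). (P t1, P t2, P t3)) (pair_pmf T (pair_pmf T T))"
    by (simp add: b_def pair_map_pmf1 pair_map_pmf2 pmf.map_comp o_def case_prod_beta apfst_def apsnd_def map_prod_def split_beta')
  moreover have "(\<lambda>(t1, t2, t3). (P t1, P t2, P t3)) -` ?X
     = {(t1, t2, t3). \<not> (P t1 \<and> P t2 \<or> P t1 \<and> P t3 \<or> P t2 \<and> P t3)}"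
    by auto
  ultimately have "measure_pmf.prob (pair_pmf T (pair_pmf T T))
      {(t1, t2, t3). \<not> (P t1 \<and> P t2 \<or> P t1 \<and> P t3 \<or> P t2 \<and> P t3)}
    = measure_pmf.prob (pair_pmf b (pair_pmf b b)) ?X"
    by simp
  also have "\<dots> = (\<Sum>x\<in>?X. pmf b (fst x) * pmf b (fst (snd x)) * pmf b (snd (snd x)))"
    by (subst measure_measure_pmf_finite) (auto intro!: sum.cong simp only: pmf_pair fst_conv snd_conv)
  also have "\<dots> = q * q * q + 3 * (1 - q) * q * q"
    by (simp add: t flip: q_def)
  \<comment> \<open>The polynomial is \<open>3 * q^2 - 2 * q^3\<close>, with value
    \<open>7/27\<close> at \<open>q = 1/3\<close>. Factoring \<open>1/3 - q\<close> out of the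
    difference leaves a cofactor that is nonnegative for \<open>0 \<le> q \<le> 1/3\<close>.\<close>
  also have "\<dots> = 7/27 - (1/3 - q) * (7/9 + q / 3 + 2 * q * (1 - q))"
    by (simp add: field_simps)
  also have "\<dots> \<le> 7/27"
    using q by simp
  finally show ?thesis .
qed

section \<open>Query trees\<close>

lemma run_cong: "(\<And>q. q \<in> queries t \<Longrightarrow> f q = g q) \<Longrightarrow> run t f = run t g"
  by (induction t) auto

lemma finite_queries: "finite (queries t)"
  by (induction t) auto

text \<open>A tree may contain exponentially many queries, but for fixed answers \<open>f\<close>
  only those on one path are asked, at most \<open>query_count t\<close> of them. Union bounds run
  over this path and so cost only a factor linear in the query complexity.\<close>

fun query_path :: "'q query_tree \<Rightarrow> ('q \<Rightarrow> bool) \<Rightarrow> 'q set" where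
  "query_path (Verdict b) f = {}"
| "query_path (Query q t0 t1) f = insert q (query_path (if f q then t1 else t0) f)"

lemma query_path_subset: "query_path t f \<subseteq> queries t"
  by (induction t) auto

lemma finite_query_path: "finite (query_path t f)"
  by (rule finite_subset[OF query_path_subset finite_queries])

lemma card_query_path: "card (query_path t f) \<le> query_count t"
proof (induction t)
  case (Query q t0 t1)
  then show ?case
    by (auto simp: card_insert_if finite_query_path)
qed simp

section \<open>Composition of query trees\<close>

fun bind_tree :: "'q query_tree \<Rightarrow> (bool \<Rightarrow> 'q query_tree) \<Rightarrow> 'q query_tree" where
  "bind_tree (Verdict b) k = k b"
| "bind_tree (Query q t0 t1) k = Query q (bind_tree t0 k) (bind_tree t1 k)"

lemma run_bind_tree: "run (bind_tree t k) f = run (k (run t f)) f"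
  by (induction t) auto

lemma queries_bind_tree: "queries (bind_tree t k) \<subseteq> queries t \<union> (\<Union>b. queries (k b))"
  by (induction t) auto

lemma query_count_bind_tree:
  assumes "\<And>b. query_count (k b) \<le> c"
  shows "query_count (bind_tree t k) \<le> query_count t + c"
  by (induction t) (auto simp: assms)

text \<open>The last argument collects the answers received so far.\<close>

fun ask :: "'q list \<Rightarrow> (('q \<Rightarrow> bool) \<Rightarrow> 'q query_tree) \<Rightarrow> ('q \<Rightarrow> bool) \<Rightarrow> 'q query_tree" where
  "ask [] k g = k g"
| "ask (q # qs) k g = Query q (ask qs k (g(q := False))) (ask qs k (g(q := True)))"

text \<open>Repeated queries are harmless: all answers come from the same \<open>f\<close>, so the
  final record depends only on the set of queries.\<close>

lemma run_ask: "run (ask qs k g) f = run (k (override_on g f (set qs))) f"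
proof (induction qs arbitrary: g)
  case (Cons q qs)
  have "override_on (g(q := f q)) f (set qs) = override_on g f (set (q # qs))"
    by (auto simp: override_on_def fun_eq_iff)
  then show ?case
    using Cons.IH[of "g(q := f q)"] by (cases "f q") (simp_all del: fun_upd_apply)
qed (simp add: override_on_def)

lemma queries_ask: "queries (ask qs k g) \<subseteq> set qs \<union> (\<Union>h. queries (k h))"
proof (induction qs arbitrary: g)
  case (Cons q qs)
  show ?case
    using Cons.IH[of "g(q := False)"] Cons.IH[of "g(q := True)"] by (simp del: fun_upd_apply) blast
qed auto

lemma query_count_ask:
  assumes "\<And>h. query_count (k h) \<le> c"
  shows "query_count (ask qs k g) \<le> length qs + c"
  by (induction qs arbitrary: g) (auto simp: assms)

definition majority_tree :: "'q query_tree \<Rightarrow> 'q query_tree \<Rightarrow> 'q query_tree \<Rightarrow> 'q query_tree" where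
  "majority_tree t1 t2 t3 = bind_tree t1 (\<lambda>a. bind_tree t2 (\<lambda>b. bind_tree t3 (\<lambda>c.
     Verdict (a \<and> b \<or> a \<and> c \<or> b \<and> c))))"

lemma run_majority_tree:
  "run (majority_tree t1 t2 t3) f \<longleftrightarrow>
    run t1 f \<and> run t2 f \<or> run t1 f \<and> run t3 f \<or> run t2 f \<and> run t3 f"
  by (simp add: majority_tree_def run_bind_tree)

lemma queries_majority_tree: "queries (majority_tree t1 t2 t3) \<subseteq> queries t1 \<union> queries t2 \<union> queries t3"
  unfolding majority_tree_def
  by (intro subset_trans[OF queries_bind_tree] Un_least UN_least) auto

lemma query_count_majority_tree:
  "query_count (majority_tree t1 t2 t3) \<le> query_count t1 + (query_count t2 + (query_count t3 + 0))"
  unfolding majority_tree_def by (intro query_count_bind_tree) simp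

section \<open>Reading a bit by a clear majority of samples\<close>

definition agrees :: "nat \<Rightarrow> real \<Rightarrow> (nat \<times> nat \<Rightarrow> bool) \<Rightarrow> nat \<Rightarrow> bool \<Rightarrow> bool" where
  "agrees m \<theta> f i b \<longleftrightarrow> real (card {j. j < m \<and> f (j, i) \<noteq> b}) \<le> \<theta> * m"

text \<open>Each sample disagrees with one of two distinct bits, so the two counts of disagreements
  add up to at least \<open>m\<close>. They cannot both be below \<open>m / 2\<close>.\<close>

lemma agrees_unique:
  assumes "agrees m \<theta> f i b" "agrees m \<theta> f i c" "0 < m" "\<theta> < 1/2"
  shows "b = c"
proof (rule ccontr)
  assume "b \<noteq> c"
  then have "{..<m} = {j. j < m \<and> f (j, i) \<noteq> b} \<union> {j. j < m \<and> f (j, i) \<noteq> c}"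
    by auto
  then have "card {..<m} \<le> card {j. j < m \<and> f (j, i) \<noteq> b} + card {j. j < m \<and> f (j, i) \<noteq> c}"
    by (simp only: card_Un_le)
  then have "real m \<le> \<theta> * m + \<theta> * m"
    using assms(1,2) unfolding agrees_def card_lessThan by linarith
  moreover have "\<theta> * m < 1/2 * m"
    using assms(3,4) by (intro mult_strict_right_mono) auto
  ultimately show False
    by simp
qed

text \<open>A query that neither answer fits is a reason to reject. Under an arbitrary distribution a marginal
  may be close to 1/2, so that a plain majority vote would return a useless bit; demanding a clear
  majority leaves only the correct majority bit or rejection as likely outcomes.\<close>

primrec emulate :: "nat \<Rightarrow> real \<Rightarrow> nat query_tree \<Rightarrow> (nat \<times> nat) query_tree" where
  "emulate m \<theta> (Verdict b) = Verdict b"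
| "emulate m \<theta> (Query i t0 t1) = ask (map (\<lambda>j. (j, i)) [0..<m])
     (\<lambda>f. if agrees m \<theta> f i False then emulate m \<theta> t0
          else if agrees m \<theta> f i True then emulate m \<theta> t1
          else Verdict False) (\<lambda>_. False)"

text \<open>Only bit \<open>i\<close> of the first \<open>m\<close> samples is inspected; once these
  bits have been asked, the placeholder answers in \<open>g\<close> never show.\<close>

lemma agrees_override_on:
  assumes "\<And>j. j < m \<Longrightarrow> (j, i) \<in> A"
  shows "agrees m \<theta> (override_on g f A) i b = agrees m \<theta> f i b"
  unfolding agrees_def using assms by (simp add: override_on_def cong: conj_cong)

lemma run_emulate_Query:
  "run (emulate m \<theta> (Query i t0 t1)) f \<longleftrightarrow>
     (if agrees m \<theta> f i False then run (emulate m \<theta> t0) f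
      else agrees m \<theta> f i True \<and> run (emulate m \<theta> t1) f)"
  by (auto simp: run_ask agrees_override_on)

lemma queries_emulate: "queries (emulate m \<theta> t) \<subseteq> {..<m} \<times> queries t"
proof (induction t)
  case (Query i t0 t1)
  show ?case
    unfolding emulate.simps by (rule subset_trans[OF queries_ask]) (use Query in \<open>auto split: if_splits\<close>)
qed simp

lemma query_count_emulate: "query_count (emulate m \<theta> t) \<le> query_count t * m"
proof (induction t)
  case (Query i t0 t1)
  have "query_count (emulate m \<theta> (Query i t0 t1)) \<le>
      length (map (\<lambda>j. (j, i)) [0..<m]) + max (query_count t0) (query_count t1) * m"
    unfolding emulate.simps
    by (rule query_count_ask)
      (use Query in \<open>auto intro: order_trans[OF _ mult_le_mono1] simp: le_max_iff_disj\<close>)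
  then show ?case
    by simp
qed simp

text \<open>For completeness. Agreement is required only on the path that the true answers
  \<open>f\<close> determine. There a clear majority excludes the opposite answer, so the emulation
  follows this path to the same leaf.\<close>

lemma run_emulate_if_agrees:
  assumes "\<And>i. i \<in> query_path t f \<Longrightarrow> agrees m \<theta> g i (f i)" "0 < m" "\<theta> < 1/2"
  shows "run (emulate m \<theta> t) g = run t f"
  using assms(1)
proof (induction t)
  case (Query i t0 t1)
  have "agrees m \<theta> g i (f i)"
    using Query.prems by simp
  then have "agrees m \<theta> g i b \<longleftrightarrow> b = f i" for b
    using agrees_unique[of m \<theta> g i] assms(2,3) by blast
  with Query show ?case
    by (auto simp: run_emulate_Query simp del: emulate.simps)
qed simp

text \<open>For soundness. If no wrong bit passes on the path of \<open>f\<close>, the emulation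
  takes the correct branch or rejects at each node, so it can accept only at the leaf that
  \<open>f\<close> reaches.\<close>

lemma run_emulate_imp_run:
  assumes "\<And>i. i \<in> query_path t f \<Longrightarrow> \<not> agrees m \<theta> g i (\<not> f i)" "run (emulate m \<theta> t) g"
  shows "run t f"
  using assms
proof (induction t)
  case (Query i t0 t1)
  have "\<not> agrees m \<theta> g i (\<not> f i)"
    using Query.prems by simp
  with Query show ?case
    by (cases "f i") (auto simp: run_emulate_Query simp del: emulate.simps split: if_splits)
qed simp

text \<open>The same random positions serve two purposes: the columns of the sampled bit matrix
  test the marginals, and its rows estimate the distances of the samples from the centre, whose bits are
  \<open>y\<close>.\<close>

definition matrix_ok :: "nat \<Rightarrow> real \<Rightarrow> real \<Rightarrow> (nat \<Rightarrow> nat) \<Rightarrow> (nat \<times> nat \<Rightarrow> bool) \<Rightarrow> bool" where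
  "matrix_ok m \<theta> \<tau> J f \<longleftrightarrow> (\<exists>y. (\<forall>l<m. agrees m \<theta> f (J l) (y (J l))) \<and>
     (\<forall>j<m. real (card {l. l < m \<and> f (j, J l) \<noteq> y (J l)}) \<le> \<tau> * m))"

definition matrix_tree :: "nat \<Rightarrow> real \<Rightarrow> real \<Rightarrow> (nat \<Rightarrow> nat) \<Rightarrow> (nat \<times> nat) query_tree" where
  "matrix_tree m \<theta> \<tau> J = ask [(j, J l). j \<leftarrow> [0..<m], l \<leftarrow> [0..<m]]
     (\<lambda>f. Verdict (matrix_ok m \<theta> \<tau> J f)) (\<lambda>_. False)"

lemma run_matrix_tree: "run (matrix_tree m \<theta> \<tau> J) f \<longleftrightarrow> matrix_ok m \<theta> \<tau> J f"
proof -
  let ?A = "set [(j, J l). j \<leftarrow> [0..<m], l \<leftarrow> [0..<m]]"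
  have A: "(j, J l) \<in> ?A" if "j < m" "l < m" for j l
    using that by (auto intro!: bexI[of _ j])
  have "agrees m \<theta> (override_on g f ?A) (J l) b = agrees m \<theta> f (J l) b" if "l < m" for g b l
    by (rule agrees_override_on) (use A that in blast)
  moreover have "{l. l < m \<and> override_on g f ?A (j, J l) \<noteq> y (J l)} = {l. l < m \<and> f (j, J l) \<noteq> y (J l)}"
    if "j < m" for g j y
    using A that by (auto simp: override_on_def)
  ultimately show ?thesis
    by (simp add: matrix_tree_def run_ask matrix_ok_def cong: conj_cong del: set_concat)
qed

lemma queries_matrix_tree: "queries (matrix_tree m \<theta> \<tau> J) \<subseteq> {..<m} \<times> J ` {..<m}"
  unfolding matrix_tree_def by (rule subset_trans[OF queries_ask]) auto

lemma query_count_matrix_tree: "query_count (matrix_tree m \<theta> \<tau> J) \<le> m * m"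
  unfolding matrix_tree_def
  by (rule order_trans[OF query_count_ask[where c = 0]])
    (auto simp: length_concat comp_def sum_list_triv)

definition tester_tree ::
  "nat \<Rightarrow> real \<Rightarrow> nat \<Rightarrow> real \<Rightarrow> real \<Rightarrow> nat query_tree \<times> (nat \<Rightarrow> nat) \<Rightarrow> (nat \<times> nat) query_tree" where
  "tester_tree m\<^sub>0 \<theta>\<^sub>0 m \<theta> \<tau> = (\<lambda>(t, J). bind_tree (emulate m\<^sub>0 \<theta>\<^sub>0 t)
     (\<lambda>b. if b then matrix_tree m \<theta> \<tau> J else Verdict False))"

lemma run_tester_tree:
  "run (tester_tree m\<^sub>0 \<theta>\<^sub>0 m \<theta> \<tau> (t, J)) f \<longleftrightarrow> run (emulate m\<^sub>0 \<theta>\<^sub>0 t) f \<and> matrix_ok m \<theta> \<tau> J f"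
  by (simp add: tester_tree_def run_bind_tree run_matrix_tree)

lemma queries_tester_tree:
  "queries (tester_tree m\<^sub>0 \<theta>\<^sub>0 m \<theta> \<tau> (t, J)) \<subseteq> {..<m\<^sub>0} \<times> queries t \<union> {..<m} \<times> J ` {..<m}"
proof -
  have "queries (tester_tree m\<^sub>0 \<theta>\<^sub>0 m \<theta> \<tau> (t, J)) \<subseteq>
      queries (emulate m\<^sub>0 \<theta>\<^sub>0 t) \<union> queries (matrix_tree m \<theta> \<tau> J)"
    unfolding tester_tree_def prod.case
    by (rule subset_trans[OF queries_bind_tree]) (auto split: if_splits)
  with queries_emulate queries_matrix_tree show ?thesis
    by blast
qed

lemma query_count_tester_tree:
  "query_count (tester_tree m\<^sub>0 \<theta>\<^sub>0 m \<theta> \<tau> (t, J)) \<le> query_count t * m\<^sub>0 + m * m"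
proof -
  have "query_count (tester_tree m\<^sub>0 \<theta>\<^sub>0 m \<theta> \<tau> (t, J)) \<le> query_count (emulate m\<^sub>0 \<theta>\<^sub>0 t) + m * m"
    unfolding tester_tree_def prod.case
    by (rule query_count_bind_tree) (simp add: query_count_matrix_tree)
  with query_count_emulate[of m\<^sub>0 \<theta>\<^sub>0 t] show ?thesis
    by linarith
qed

text \<open>The model draws exactly the samples that a tree mentions. Drawing the first
  \<open>N\<close> samples for every tree does not change the verdict, and it makes the tree and the
  samples a product distribution.\<close>

lemma doho_verdict_eq:
  assumes "\<And>t. t \<in> set_pmf T \<Longrightarrow> fst ` queries t \<subseteq> {..<N}"
  shows "doho_verdict T P =
    map_pmf (\<lambda>(t, s). run t (\<lambda>(j, i). s j ! i)) (pair_pmf T (Pi_pmf {..<N} [] (\<lambda>_. P)))"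
proof -
  have "map_pmf (\<lambda>s. run t (\<lambda>(j, i). s j ! i)) (Pi_pmf (fst ` queries t) [] (\<lambda>_. P))
      = map_pmf (\<lambda>s. run t (\<lambda>(j, i). s j ! i)) (Pi_pmf {..<N} [] (\<lambda>_. P))"
    if "t \<in> set_pmf T" for t
  proof -
    have "run t (\<lambda>(j, i). (if j \<in> fst ` queries t then s j else []) ! i) = run t (\<lambda>(j, i). s j ! i)" for s
      by (rule run_cong) force
    then show ?thesis
      by (subst Pi_pmf_subset[OF _ assms[OF that]]) (simp_all add: pmf.map_comp o_def)
  qed
  then have "doho_verdict T P = bind_pmf T (\<lambda>t. map_pmf (\<lambda>s. run t (\<lambda>(j, i). s j ! i)) (Pi_pmf {..<N} [] (\<lambda>_. P)))"
    unfolding doho_verdict_def by (intro bind_pmf_cong refl)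
  then show ?thesis
    by (simp add: map_pmf_def pair_pmf_def bind_assoc_pmf bind_return_pmf)
qed

section \<open>Upper bounds for the earth mover's distance\<close>

lemma finite_bitstrings: "finite (bitstrings n)"
  using finite_lists_length_eq[of "UNIV :: bool set" n] by (simp add: bitstrings_def)

lemma hamming_dist_nonneg: "0 \<le> hamming_dist n x y"
  by (simp add: hamming_dist_def)

text \<open>The point masses of a coupling form a transport plan of the same cost. As
  \<open>emd\<close> is an infimum of reals, the costs must also be bounded below, here by
  0.\<close>

lemma emd_le_coupling:
  assumes "map_pmf fst R \<in> distributions n" and "map_pmf snd R \<in> distributions n"
  shows "emd n (map_pmf fst R) (map_pmf snd R) \<le>
    measure_pmf.expectation R (\<lambda>(x, y). hamming_dist n x y)"
proof -
  let ?B = "bitstrings n"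
  define w where "w = (\<lambda>x y. pmf R (x, y))"
  have R: "set_pmf R \<subseteq> ?B \<times> ?B"
    using assms by (auto simp: distributions_def)
  have "(\<Sum>y\<in>?B. w x y) = pmf (map_pmf fst R) x" for x
  proof -
    have "(\<Sum>y\<in>?B. w x y) = (\<Sum>q\<in>{x} \<times> ?B. pmf R q)"
      by (simp add: w_def sum.cartesian_product')
    also have "\<dots> = measure_pmf.prob R ({x} \<times> ?B)"
      by (rule measure_measure_pmf_finite[symmetric]) (simp add: finite_bitstrings)
    also have "\<dots> = measure_pmf.prob R (fst -` {x})"
      by (rule measure_pmf.finite_measure_eq_AE) (use R in \<open>auto simp: AE_measure_pmf_iff\<close>)
    finally show ?thesis
      by (simp add: pmf_map)
  qed
  moreover have "(\<Sum>x\<in>?B. w x y) = pmf (map_pmf snd R) y" for y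
  proof -
    have "(\<Sum>x\<in>?B. w x y) = (\<Sum>q\<in>?B \<times> {y}. pmf R q)"
      by (simp add: w_def sum.cartesian_product')
    also have "\<dots> = measure_pmf.prob R (?B \<times> {y})"
      by (rule measure_measure_pmf_finite[symmetric]) (simp add: finite_bitstrings)
    also have "\<dots> = measure_pmf.prob R (snd -` {y})"
      by (rule measure_pmf.finite_measure_eq_AE) (use R in \<open>auto simp: AE_measure_pmf_iff\<close>)
    finally show ?thesis
      by (simp add: pmf_map)
  qed
  ultimately have plan: "transport_plan n (map_pmf fst R) (map_pmf snd R) w"
    by (simp add: transport_plan_def w_def)
  have "measure_pmf.expectation R (\<lambda>(x, y). hamming_dist n x y)
      = (\<Sum>q\<in>?B \<times> ?B. pmf R q *\<^sub>R (\<lambda>(x, y). hamming_dist n x y) q)"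
    by (rule integral_measure_pmf) (use R in \<open>auto simp: finite_bitstrings\<close>)
  also have "\<dots> = (\<Sum>x\<in>?B. \<Sum>y\<in>?B. w x y * hamming_dist n x y)"
    by (subst sum.cartesian_product) (simp add: w_def case_prod_beta)
  finally have cost: "measure_pmf.expectation R (\<lambda>(x, y). hamming_dist n x y)
      = (\<Sum>x\<in>?B. \<Sum>y\<in>?B. w x y * hamming_dist n x y)" .
  show ?thesis
    unfolding emd_def cost
  proof (rule cInf_lower)
    show "bdd_below {\<Sum>x\<in>?B. \<Sum>y\<in>?B. w x y * hamming_dist n x y |w.
        transport_plan n (map_pmf fst R) (map_pmf snd R) w}"
      by (rule bdd_belowI[of _ 0])
        (auto simp: transport_plan_def intro!: sum_nonneg mult_nonneg_nonneg hamming_dist_nonneg)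
  qed (use plan in blast)
qed

text \<open>Keep at most \<open>k\<close> of the disagreements of a sample with \<open>x\<close>, then erase
  a kept disagreement in position \<open>i\<close> with the probability that brings the marginal down to
  \<open>\<eta>\<close>; finally impose what is left on \<open>z\<close> instead of
  \<open>x\<close>.\<close>

lemma emd_D_per_le:
  fixes n :: nat and \<eta> \<delta> :: real
  defines "k \<equiv> nat \<lfloor>\<delta> * n\<rfloor>"
  assumes n: "0 < n" and P: "P \<in> distributions n" and \<eta>: "0 \<le> \<eta>" and \<delta>: "0 \<le> \<delta>"
  shows "\<exists>P'\<in>D_per n \<eta> \<delta> z. emd n P P' \<le> hamming_dist n x z
    + (\<Sum>i<n. max 0 (measure_pmf.prob P {v. v ! i \<noteq> x ! i} - \<eta>)) / n
    + measure_pmf.expectation P (\<lambda>v. real (card {i. i < n \<and> v ! i \<noteq> x ! i} - k) / n)"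
proof -
  \<comment> \<open>Rounding down yields a whole number of disagreements to keep that still respects
    the bound \<open>\<delta> * n\<close>.\<close>
  have k: "real k \<le> \<delta> * n"
    using \<delta> by (simp add: k_def)
  define D where "D = (\<lambda>v :: bool list. {i. i < n \<and> v ! i \<noteq> x ! i})"
  have finD: "finite (D v)" for v
    by (simp add: D_def)
  have "\<exists>K\<subseteq>D v. card K = min k (card (D v))" for v
    by (metis min.cobounded2 obtain_subset_with_card_n)
  then obtain keep where keep: "\<And>v. keep v \<subseteq> D v" "\<And>v. card (keep v) = min k (card (D v))"
    by metis
  have keep_less: "i < n" if "i \<in> keep v" for i v
    using keep(1)[of v] that by (auto simp: D_def)
  define q where "q = (\<lambda>i. measure_pmf.prob P {v. i \<in> keep v})"
  \<comment> \<open>If \<open>q i\<close> exceeds \<open>\<eta>\<close>, this makes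
    \<open>q i * (1 - c i)\<close>, the probability of a kept and surviving disagreement, equal to
    \<open>\<eta>\<close>. Otherwise nothing is erased, which also avoids a division by 0.\<close>
  define c where "c = (\<lambda>i. if q i \<le> \<eta> then 0 else 1 - \<eta> / q i)"
  have c01: "c i \<in> {0..1}" for i
    using \<eta> by (auto simp: c_def field_simps)
  have q_le: "q i \<le> measure_pmf.prob P {v. v ! i \<noteq> x ! i}" for i
    unfolding q_def by (rule measure_pmf.finite_measure_mono) (use keep(1) in \<open>auto simp: D_def\<close>)
  have cq: "q i * c i = max 0 (q i - \<eta>)" and cq': "q i * (1 - c i) \<le> \<eta>" for i
    using \<eta> by (auto simp: c_def field_simps)
  \<comment> \<open>One coin per position, with \<open>True\<close> meaning erasure; the coins are
    drawn independently of the sample.\<close>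
  define C where "C = Pi_pmf {..<n} False (\<lambda>i. bernoulli_pmf (c i))"
  define W where "W = pair_pmf P C"
  have finW: "finite (set_pmf W)"
  proof -
    have "finite (set_pmf P)"
      using P finite_subset[OF _ finite_bitstrings] by (auto simp: distributions_def)
    moreover have "finite (set_pmf C)"
      unfolding C_def by (subst set_Pi_pmf) (simp, rule finite_PiE_dflt, simp_all)
    ultimately show ?thesis
      by (simp add: W_def)
  qed
  have int: "integrable (measure_pmf W) f" for f :: "_ \<Rightarrow> real"
    by (rule integrable_measure_pmf_finite[OF finW])
  have W_prob: "measure_pmf.prob W {(v, u). i \<in> keep v \<and> u i = b} = q i * pmf (bernoulli_pmf (c i)) b"
    if "i < n" for i b
  proof -
    have "map_pmf (\<lambda>(v, u). (v, u i)) W = pair_pmf P (bernoulli_pmf (c i))"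
      using map_pair[of "\<lambda>v. v" "\<lambda>u. u i" P C] that
      by (simp add: W_def C_def Pi_pmf_component)
    moreover have "(\<lambda>(v, u). (v, u i)) -` ({v. i \<in> keep v} \<times> {b}) = {(v, u). i \<in> keep v \<and> u i = b}"
      by auto
    ultimately have "measure_pmf.prob W {(v, u). i \<in> keep v \<and> u i = b}
        = measure_pmf.prob (pair_pmf P (bernoulli_pmf (c i))) ({v. i \<in> keep v} \<times> {b})"
      using measure_map_pmf[of "\<lambda>(v, u). (v, u i)" W "{v. i \<in> keep v} \<times> {b}"] by simp
    also have "\<dots> = q i * pmf (bernoulli_pmf (c i)) b"
      by (subst measure_pmf_prob_product) (auto simp: q_def measure_pmf_single)
    finally show ?thesis .
  qed
  define Y where "Y = (\<lambda>v u. map (\<lambda>i. if i \<in> keep v \<and> \<not> u i then \<not> z ! i else z ! i) [0..<n])"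
  have Y: "Y v u ! i \<noteq> z ! i \<longleftrightarrow> i \<in> keep v \<and> \<not> u i" if "i < n" for v u i
    using that by (simp add: Y_def)
  define R where "R = map_pmf (\<lambda>(v, u). (v, Y v u)) W"
  define P' where "P' = map_pmf snd R"
  have fst: "map_pmf fst R = P"
    by (simp add: R_def pmf.map_comp o_def case_prod_beta W_def map_fst_pair_pmf)
  have P'_eq: "P' = map_pmf (\<lambda>(v, u). Y v u) W"
    by (simp add: P'_def R_def pmf.map_comp o_def case_prod_beta')
  have P'_dist: "P' \<in> distributions n"
    by (auto simp: distributions_def P'_eq bitstrings_def Y_def)
  have "P' \<in> D_per n \<eta> \<delta> z"
    unfolding D_per_def
  proof (intro CollectI conjI allI impI P'_dist)
    fix i assume i: "i < n"
    have "measure_pmf.prob P' {y. y ! i \<noteq> z ! i} = measure_pmf.prob W {(v, u). i \<in> keep v \<and> u i = False}"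
      by (auto simp: P'_eq Y_def i intro!: arg_cong[where f = "measure_pmf.prob W"])
    also have "\<dots> \<le> \<eta>"
      using W_prob[OF i, of False] c01[of i] cq'[of i] by simp
    finally show "measure_pmf.prob P' {y. y ! i \<noteq> z ! i} \<le> \<eta>" .
  next
    have "real (card {i. i < n \<and> Y v u ! i \<noteq> z ! i}) \<le> \<delta> * real n" for v u
    proof -
      have "card {i. i < n \<and> Y v u ! i \<noteq> z ! i} \<le> card (keep v)"
        by (rule card_mono) (use Y finite_subset[OF keep(1) finD] in auto)
      also have "\<dots> \<le> k"
        by (simp add: keep)
      finally show ?thesis
        using k by simp
    qed
    then show "measure_pmf.prob P' {y. real (card {i. i < n \<and> y ! i \<noteq> z ! i}) \<le> \<delta> * real n} = 1"
      by (subst measure_pmf.prob_eq_1) (auto simp: AE_measure_pmf_iff P'_eq)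
  qed
  moreover have "emd n P P' \<le> hamming_dist n x z
    + (\<Sum>i<n. max 0 (measure_pmf.prob P {v. v ! i \<noteq> x ! i} - \<eta>)) / n
    + measure_pmf.expectation P (\<lambda>v. real (card {i. i < n \<and> v ! i \<noteq> x ! i} - k) / n)"
  proof -
    \<comment> \<open>Three sources of disagreement between \<open>v\<close> and
      \<open>Y v u\<close>: positions where \<open>x\<close> and \<open>z\<close> differ, kept
      disagreements that were erased, and disagreements that were not kept. Elsewhere a surviving
      disagreement is copied and the two strings coincide.\<close>
    have pt: "hamming_dist n v (Y v u) \<le> hamming_dist n x z
        + (\<Sum>i<n. indicator {(v, u). i \<in> keep v \<and> u i = True} (v, u)) / n + real (card (D v) - k) / n" for v u
    proof -
      have "{i. i < n \<and> v ! i \<noteq> Y v u ! i} \<subseteq>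
          {i. i < n \<and> x ! i \<noteq> z ! i} \<union> {i. i < n \<and> i \<in> keep v \<and> u i} \<union> (D v - keep v)"
        using Y[of _ v u] keep(1)[of v] by (auto simp: D_def)
      then have "card {i. i < n \<and> v ! i \<noteq> Y v u ! i} \<le>
          card ({i. i < n \<and> x ! i \<noteq> z ! i} \<union> {i. i < n \<and> i \<in> keep v \<and> u i} \<union> (D v - keep v))"
        by (rule card_mono[rotated]) (auto simp: finD)
      also have "\<dots> \<le> card {i. i < n \<and> x ! i \<noteq> z ! i} + card {i. i < n \<and> i \<in> keep v \<and> u i} + card (D v - keep v)"
        by (meson add_mono card_Un_le le_refl order_trans)
      \<comment> \<open>Truncated subtraction covers the samples with at most \<open>k\<close>
        disagreements, which lose none.\<close>
      also have "card (D v - keep v) = card (D v) - k"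
        using card_Diff_subset[OF finite_subset[OF keep(1) finD] keep(1), of v] by (simp add: keep(2))
      also have "card {i. i < n \<and> i \<in> keep v \<and> u i} = (\<Sum>i<n. indicator {(v, u). i \<in> keep v \<and> u i = True} (v, u))"
        by (subst card_eq_sum) (auto simp: indicator_def intro!: arg_cong[where f = card])
      finally have "real (card {i. i < n \<and> v ! i \<noteq> Y v u ! i}) \<le> real (card {i. i < n \<and> x ! i \<noteq> z ! i}
          + (\<Sum>i<n. indicator {(v, u). i \<in> keep v \<and> u i = True} (v, u)) + (card (D v) - k))"
        by linarith
      also have "\<dots> = real (card {i. i < n \<and> x ! i \<noteq> z ! i})
          + (\<Sum>i<n. indicator {(v, u). i \<in> keep v \<and> u i = True} (v, u)) + real (card (D v) - k)"
        by (simp add: indicator_def of_bool_def if_distrib cong: if_cong)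
      finally show ?thesis
        unfolding hamming_dist_def add_divide_distrib[symmetric] by (rule divide_right_mono) simp
    qed
    have "emd n P P' \<le> measure_pmf.expectation R (\<lambda>(x, y). hamming_dist n x y)"
      using emd_le_coupling[of R n] P P'_dist by (simp add: fst P'_def)
    also have "\<dots> = measure_pmf.expectation W (\<lambda>(v, u). hamming_dist n v (Y v u))"
      by (simp add: R_def case_prod_beta')
    also have "\<dots> \<le> measure_pmf.expectation W (\<lambda>p. hamming_dist n x z
        + (\<Sum>i<n. indicator {(v, u). i \<in> keep v \<and> u i = True} p) / n + real (card (D (fst p)) - k) / n)"
      by (intro integral_mono int) (use pt in \<open>auto simp del: sum_divide_distrib\<close>)
    also have "\<dots> = hamming_dist n x z
        + (\<Sum>i<n. measure_pmf.prob W {(v, u). i \<in> keep v \<and> u i = True}) / n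
        + measure_pmf.expectation W (\<lambda>p. real (card (D (fst p)) - k) / n)"
      by (simp add: Bochner_Integration.integral_add int Bochner_Integration.integral_sum)
    also have "measure_pmf.expectation W (\<lambda>p. real (card (D (fst p)) - k) / n)
        = measure_pmf.expectation P (\<lambda>v. real (card (D v) - k) / n)"
      unfolding W_def by (rule expectation_pair_pmf_fst)
    \<comment> \<open>Keeping only part of the disagreements can only lower each marginal, so the
      erased mass is at most the excess of the original marginal.\<close>
    also have "(\<Sum>i<n. measure_pmf.prob W {(v, u). i \<in> keep v \<and> u i = True})
        \<le> (\<Sum>i<n. max 0 (measure_pmf.prob P {v. v ! i \<noteq> x ! i} - \<eta>))"
    proof (rule sum_mono)
      fix i assume "i \<in> {..<n}"
      then show "measure_pmf.prob W {(v, u). i \<in> keep v \<and> u i = True}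
          \<le> max 0 (measure_pmf.prob P {v. v ! i \<noteq> x ! i} - \<eta>)"
        using W_prob[of i True] c01[of i] cq[of i] q_le[of i] by simp
    qed
    finally show ?thesis
      by (simp add: D_def divide_right_mono)
  qed
  ultimately show ?thesis
    by blast
qed

section \<open>Error probabilities of the subtests\<close>

abbreviation samples :: "nat \<Rightarrow> bool list pmf \<Rightarrow> (nat \<Rightarrow> bool list) pmf" where
  "samples N P \<equiv> Pi_pmf {..<N} [] (\<lambda>_. P)"

abbreviation bits :: "(nat \<Rightarrow> bool list) \<Rightarrow> nat \<times> nat \<Rightarrow> bool" where
  "bits s \<equiv> \<lambda>(j, i). s j ! i"

abbreviation coords :: "nat \<Rightarrow> nat \<Rightarrow> (nat \<Rightarrow> nat) pmf" where
  "coords m n \<equiv> Pi_pmf {..<m} 0 (\<lambda>_. pmf_of_set {..<n})"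

lemma prob_not_agrees_le:
  assumes "m \<le> N" "0 \<le> t" "measure_pmf.prob P {v. v ! i \<noteq> b} \<le> \<theta> - t"
  shows "measure_pmf.prob (samples N P) {s. \<not> agrees m \<theta> (bits s) i b} \<le> exp (- (2 * t\<^sup>2 * m))"
  using Pi_pmf_count_gt[OF assms, of "[]"] by (simp add: agrees_def)

lemma prob_agrees_le:
  assumes "m \<le> N" "0 \<le> t" "\<theta> + t \<le> measure_pmf.prob P {v. v ! i \<noteq> b}"
  shows "measure_pmf.prob (samples N P) {s. agrees m \<theta> (bits s) i b} \<le> exp (- (2 * t\<^sup>2 * m))"
  using Pi_pmf_count_le[OF assms, of "[]"] by (simp add: agrees_def)

lemma prob_neq_Not: "measure_pmf.prob P {v. v ! i \<noteq> (\<not> b)} = 1 - measure_pmf.prob P {v. v ! i \<noteq> b}"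
proof -
  have "{v. v ! i \<noteq> (\<not> b)} = {v. \<not> v ! i \<noteq> b}"
    by auto
  then show ?thesis
    by (simp only: prob_Not)
qed

text \<open>The path determined by \<open>z\<close> does not depend on the samples. Despite
  adaptivity, the union bound is therefore over a fixed set of at most \<open>q\<close>
  positions.\<close>

lemma prob_run_emulate_neq:
  assumes "m \<le> N" "0 < m" "\<theta> < 1/2" "0 \<le> a"
    and "\<And>i. i \<in> queries t \<Longrightarrow> measure_pmf.prob P {v. v ! i \<noteq> z ! i} \<le> \<theta> - a"
    and "query_count t \<le> q"
  shows "measure_pmf.prob (samples N P) {s. run (emulate m \<theta> t) (bits s) \<noteq> run t ((!) z)}
    \<le> q * exp (- (2 * a\<^sup>2 * m))"
proof -
  have "measure_pmf.prob (samples N P) {s. run (emulate m \<theta> t) (bits s) \<noteq> run t ((!) z)}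
      \<le> measure_pmf.prob (samples N P) {s. \<exists>i\<in>query_path t ((!) z). \<not> agrees m \<theta> (bits s) i (z ! i)}"
  proof (rule prob_mono_on_support)
    fix s assume "run (emulate m \<theta> t) (bits s) \<noteq> run t ((!) z)"
    then show "\<exists>i\<in>query_path t ((!) z). \<not> agrees m \<theta> (bits s) i (z ! i)"
      using run_emulate_if_agrees[of t "(!) z" m \<theta> "bits s", OF _ assms(2,3)] by blast
  qed
  also have "\<dots> \<le> card (query_path t ((!) z)) * exp (- (2 * a\<^sup>2 * m))"
    by (intro prob_bex_le finite_query_path prob_not_agrees_le assms) (rule query_path_subset[THEN subsetD])
  also have "\<dots> \<le> q * exp (- (2 * a\<^sup>2 * m))"
    using card_query_path[of t "(!) z"] assms(6) by (intro mult_right_mono) auto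
  finally show ?thesis .
qed

text \<open>Here the fixed path is that of \<open>x\<close>. The wrong bit at a position is
  contradicted by a sample with probability at least 1/2, which is at least \<open>a\<close> above
  the threshold.\<close>

lemma prob_run_emulate_and_not_run:
  assumes "m \<le> N" "\<theta> + a \<le> 1/2" "0 \<le> a"
    and "\<And>i. i \<in> queries t \<Longrightarrow> measure_pmf.prob P {v. v ! i \<noteq> x ! i} \<le> 1/2"
    and "query_count t \<le> q"
  shows "measure_pmf.prob (samples N P) {s. run (emulate m \<theta> t) (bits s) \<and> \<not> run t ((!) x)}
    \<le> q * exp (- (2 * a\<^sup>2 * m))"
proof -
  have "measure_pmf.prob (samples N P) {s. run (emulate m \<theta> t) (bits s) \<and> \<not> run t ((!) x)}
      \<le> measure_pmf.prob (samples N P) {s. \<exists>i\<in>query_path t ((!) x). agrees m \<theta> (bits s) i (\<not> x ! i)}"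
  proof (rule prob_mono_on_support)
    fix s assume "run (emulate m \<theta> t) (bits s) \<and> \<not> run t ((!) x)"
    then show "\<exists>i\<in>query_path t ((!) x). agrees m \<theta> (bits s) i (\<not> x ! i)"
      using run_emulate_imp_run[of t "(!) x" m \<theta> "bits s"] by auto
  qed
  also have "\<dots> \<le> card (query_path t ((!) x)) * exp (- (2 * a\<^sup>2 * m))"
  proof (intro prob_bex_le finite_query_path prob_agrees_le assms)
    fix i assume "i \<in> query_path t ((!) x)"
    then have "measure_pmf.prob P {v. v ! i \<noteq> x ! i} \<le> 1/2"
      by (intro assms(4)) (rule query_path_subset[THEN subsetD])
    then show "\<theta> + a \<le> measure_pmf.prob P {v. v ! i \<noteq> (\<not> x ! i)}"
      using assms(2) unfolding prob_neq_Not by linarith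
  qed
  also have "\<dots> \<le> q * exp (- (2 * a\<^sup>2 * m))"
    using card_query_path[of t "(!) x"] assms(5) by (intro mult_right_mono) auto
  finally show ?thesis .
qed

lemma set_coords:
  assumes "0 < n" "J \<in> set_pmf (coords m n)" "l < m"
  shows "J l < n"
proof -
  have "set_pmf (pmf_of_set {..<n}) = {..<n}"
    by (rule set_pmf_of_set) (use assms(1) in auto)
  with assms(2,3) show ?thesis
    by (auto simp: set_Pi_pmf PiE_dflt_def)
qed

lemma prob_coord:
  fixes n :: nat
  assumes "0 < n"
  shows "measure_pmf.prob (pmf_of_set {..<n}) {i. P i} = card {i. i < n \<and> P i} / n"
proof -
  have "{..<n} \<inter> {i. P i} = {i. i < n \<and> P i}"
    by auto
  with assms show ?thesis
    by (subst measure_pmf_of_set) auto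
qed

text \<open>The centre \<open>z\<close> serves as the witness \<open>y\<close>. Column errors are
  bounded over the samples with the positions fixed, row errors over the positions with the samples
  fixed; each union bound has \<open>m\<close> terms.\<close>

lemma prob_not_matrix_ok_le:
  fixes m n N :: nat and \<theta> \<tau> \<alpha> e :: real
  defines "e \<equiv> exp (- (2 * \<alpha>\<^sup>2 * m))"
  assumes "0 < n" "m \<le> N" "0 \<le> \<alpha>"
    and marginal: "\<And>i. i < n \<Longrightarrow> measure_pmf.prob P {v. v ! i \<noteq> z ! i} \<le> \<theta> - \<alpha>"
    and close: "\<And>v. v \<in> set_pmf P \<Longrightarrow> card {i. i < n \<and> v ! i \<noteq> z ! i} / n \<le> \<tau> - \<alpha>"
  shows "measure_pmf.prob (pair_pmf (coords m n) (samples N P))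
    {w. \<not> matrix_ok m \<theta> \<tau> (fst w) (bits (snd w))} \<le> 2 * (m * e)"
proof -
  let ?V = "pair_pmf (coords m n) (samples N P)"
  let ?E = "\<lambda>J s. \<exists>l\<in>{..<m}. \<not> agrees m \<theta> (bits s) (J l) (z ! J l)"
  let ?F = "\<lambda>J s. \<exists>j\<in>{..<m}. \<not> real (card {l. l < m \<and> J l \<in> {i. s j ! i \<noteq> z ! i}}) \<le> \<tau> * m"
  have "measure_pmf.prob ?V {w. \<not> matrix_ok m \<theta> \<tau> (fst w) (bits (snd w))}
      \<le> measure_pmf.prob ?V {w. ?E (fst w) (snd w) \<or> ?F (fst w) (snd w)}"
  proof (rule prob_mono_on_support)
    fix w assume "\<not> matrix_ok m \<theta> \<tau> (fst w) (bits (snd w))"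
    then show "?E (fst w) (snd w) \<or> ?F (fst w) (snd w)"
      unfolding matrix_ok_def by (auto dest!: spec[of _ "(!) z"])
  qed
  also have "\<dots> \<le> measure_pmf.prob ?V {w. ?E (fst w) (snd w)} + measure_pmf.prob ?V {w. ?F (fst w) (snd w)}"
    by (rule prob_disj_le)
  also have "measure_pmf.prob ?V {w. ?E (fst w) (snd w)} \<le> card {..<m} * e"
  proof (intro prob_pair_pmf_le prob_bex_le)
    fix J l assume "J \<in> set_pmf (coords m n)" "l \<in> {..<m}"
    then have "J l < n"
      using set_coords assms(2) by blast
    then show "measure_pmf.prob (samples N P) {s. \<not> agrees m \<theta> (bits s) (J l) (z ! J l)} \<le> e"
      unfolding e_def by (intro prob_not_agrees_le assms)
  qed simp
  also have "measure_pmf.prob ?V {w. ?F (fst w) (snd w)} \<le> card {..<m} * e"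
  proof (intro prob_pair_pmf_le' prob_bex_le)
    fix s j assume "s \<in> set_pmf (samples N P)" "j \<in> {..<m}"
    then have "s j \<in> set_pmf P"
      using assms(3) by (auto simp: set_Pi_pmf PiE_dflt_def)
    then have "measure_pmf.prob (pmf_of_set {..<n}) {i. s j ! i \<noteq> z ! i} \<le> \<tau> - \<alpha>"
      unfolding prob_coord[OF assms(2)] by (rule close)
    then show "measure_pmf.prob (coords m n)
        {J. \<not> real (card {l. l < m \<and> J l \<in> {i. s j ! i \<noteq> z ! i}}) \<le> \<tau> * m} \<le> e"
      unfolding e_def by (intro Pi_pmf_count_gt order_refl assms(4))
  qed simp
  finally show ?thesis
    by (simp add: mult_ac)
qed

text \<open>At a bad position both bits are contradicted with probability at least
  \<open>\<theta> + \<alpha>\<close>. Acceptance thus means that no bad position was chosen (first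
  term) or that one of the two bits passed by accident (\<open>2 * e\<close>).\<close>

lemma prob_matrix_ok_le_if_marginals:
  fixes m n N :: nat and \<theta> \<tau> \<alpha> \<rho> e :: real
  defines "e \<equiv> exp (- (2 * \<alpha>\<^sup>2 * m))"
  assumes "0 < n" "m \<le> N" "0 \<le> \<alpha>" "\<theta> + \<alpha> \<le> 1/2" "0 \<le> \<rho>"
    and half: "\<And>i. i < n \<Longrightarrow> measure_pmf.prob P {v. v ! i \<noteq> x ! i} \<le> 1/2"
    and bad: "\<rho> \<le> measure_pmf.prob (pmf_of_set {..<n}) {i. \<theta> + \<alpha> \<le> measure_pmf.prob P {v. v ! i \<noteq> x ! i}}"
  shows "measure_pmf.prob (pair_pmf (coords m n) (samples N P))
    {w. matrix_ok m \<theta> \<tau> (fst w) (bits (snd w))} \<le> exp (- (2 * \<rho>\<^sup>2 * m)) + 2 * e"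
proof -
  let ?V = "pair_pmf (coords m n) (samples N P)"
  let ?I = "{i. \<theta> + \<alpha> \<le> measure_pmf.prob P {v. v ! i \<noteq> x ! i}}"
  let ?E = "\<lambda>J. real (card {l. l < m \<and> J l \<in> ?I}) \<le> (0::real) * m"
  let ?F = "\<lambda>J s. matrix_ok m \<theta> \<tau> J (bits s) \<and> (\<exists>l<m. J l \<in> ?I)"
  have "measure_pmf.prob ?V {w. matrix_ok m \<theta> \<tau> (fst w) (bits (snd w))}
      \<le> measure_pmf.prob ?V {w. ?E (fst w) \<or> ?F (fst w) (snd w)}"
  proof (rule prob_mono_on_support)
    fix w assume ok: "matrix_ok m \<theta> \<tau> (fst w) (bits (snd w))"
    show "?E (fst w) \<or> ?F (fst w) (snd w)"
    proof (cases "\<exists>l<m. fst w l \<in> ?I")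
      case False
      then have "{l. l < m \<and> fst w l \<in> ?I} = {}"
        by blast
      then have "?E (fst w)"
        by (simp only: card.empty)
      then show ?thesis ..
    qed (use ok in blast)
  qed
  also have "\<dots> \<le> measure_pmf.prob ?V {w. ?E (fst w)} + measure_pmf.prob ?V {w. ?F (fst w) (snd w)}"
    by (rule prob_disj_le)
  also have "measure_pmf.prob ?V {w. ?E (fst w)} \<le> exp (- (2 * \<rho>\<^sup>2 * m))"
    by (rule prob_pair_pmf_le'[where R = "\<lambda>J s. ?E J"], rule Pi_pmf_count_le) (use bad assms(6) in auto)
  also have "measure_pmf.prob ?V {w. ?F (fst w) (snd w)} \<le> 2 * e"
  proof (rule prob_pair_pmf_le)
    fix J assume J: "J \<in> set_pmf (coords m n)"
    show "measure_pmf.prob (samples N P) {s. ?F J s} \<le> 2 * e"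
    proof (cases "\<exists>l<m. J l \<in> ?I")
      case True
      then obtain l where l: "l < m" "\<theta> + \<alpha> \<le> measure_pmf.prob P {v. v ! J l \<noteq> x ! J l}"
        by blast
      have "J l < n"
        using set_coords[OF assms(2) J l(1)] .
      then have other: "\<theta> + \<alpha> \<le> measure_pmf.prob P {v. v ! J l \<noteq> (\<not> x ! J l)}"
        using half[of "J l"] assms(5) unfolding prob_neq_Not by linarith
      have e: "measure_pmf.prob (samples N P) {s. agrees m \<theta> (bits s) (J l) b} \<le> e" for b
      proof -
        have "\<theta> + \<alpha> \<le> measure_pmf.prob P {v. v ! J l \<noteq> b}"
        proof (cases "b = x ! J l")
          case True
          with l(2) show ?thesis
            by (simp only:)
        next
          case False
          then have "b = (\<not> x ! J l)"
            by blast
          with other show ?thesis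
            by (simp only:)
        qed
        then show ?thesis
          unfolding e_def by (rule prob_agrees_le[OF assms(3,4)])
      qed
      have "measure_pmf.prob (samples N P) {s. ?F J s} \<le>
          measure_pmf.prob (samples N P) {s. agrees m \<theta> (bits s) (J l) True \<or> agrees m \<theta> (bits s) (J l) False}"
      proof (rule prob_mono_on_support)
        fix s assume "?F J s"
        then obtain y where "agrees m \<theta> (bits s) (J l) (y (J l))"
          using l(1) by (auto simp: matrix_ok_def)
        then show "agrees m \<theta> (bits s) (J l) True \<or> agrees m \<theta> (bits s) (J l) False"
          by (cases "y (J l)") simp_all
      qed
      also have "\<dots> \<le> e + e"
        by (rule order_trans[OF prob_disj_le add_mono[OF e e]])
      finally show ?thesis
        by simp
    next
      case False
      then have "{s. ?F J s} = {}"
        by blast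
      then show ?thesis
        by (simp only: measure_empty) (simp add: e_def)
    qed
  qed
  finally show ?thesis
    by simp
qed

text \<open>Once a far sample is drawn, acceptance has two explanations. Either a centre bit differs
  from \<open>x\<close>, so that a wrong bit passed a column test, or the centre is \<open>x\<close>
  on the chosen positions and the far sample looks close there.\<close>

lemma prob_matrix_ok_le_if_distances:
  fixes m n N :: nat and \<theta> \<tau> \<alpha> \<rho> e :: real
  defines "e \<equiv> exp (- (2 * \<alpha>\<^sup>2 * m))"
  assumes "0 < n" "m \<le> N" "0 \<le> \<alpha>" "\<theta> + \<alpha> \<le> 1/2" "0 \<le> \<rho>"
    and half: "\<And>i. i < n \<Longrightarrow> measure_pmf.prob P {v. v ! i \<noteq> x ! i} \<le> 1/2"
    and bad: "\<rho> \<le> measure_pmf.prob P {v. \<tau> + \<alpha> \<le> card {i. i < n \<and> v ! i \<noteq> x ! i} / n}"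
  shows "measure_pmf.prob (pair_pmf (coords m n) (samples N P))
    {w. matrix_ok m \<theta> \<tau> (fst w) (bits (snd w))} \<le> exp (- (2 * \<rho>\<^sup>2 * m)) + (m * e + e)"
proof -
  let ?V = "pair_pmf (coords m n) (samples N P)"
  let ?B = "{v. \<tau> + \<alpha> \<le> card {i. i < n \<and> v ! i \<noteq> x ! i} / n}"
  let ?E = "\<lambda>s. real (card {j. j < m \<and> s j \<in> ?B}) \<le> (0::real) * m"
  let ?F = "\<lambda>J s. \<exists>l\<in>{..<m}. agrees m \<theta> (bits s) (J l) (\<not> x ! J l)"
  let ?G = "\<lambda>J s. (\<exists>j<m. s j \<in> ?B) \<and> (\<forall>j<m. real (card {l. l < m \<and> J l \<in> {i. s j ! i \<noteq> x ! i}}) \<le> \<tau> * m)"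
  have "measure_pmf.prob ?V {w. matrix_ok m \<theta> \<tau> (fst w) (bits (snd w))}
      \<le> measure_pmf.prob ?V {w. ?E (snd w) \<or> (?F (fst w) (snd w) \<or> ?G (fst w) (snd w))}"
  proof (rule prob_mono_on_support)
    fix w assume ok: "matrix_ok m \<theta> \<tau> (fst w) (bits (snd w))"
    show "?E (snd w) \<or> (?F (fst w) (snd w) \<or> ?G (fst w) (snd w))"
    proof (cases "\<exists>j<m. snd w j \<in> ?B")
      case False
      then have "{j. j < m \<and> snd w j \<in> ?B} = {}"
        by blast
      then have "?E (snd w)"
        by (simp only: card.empty)
      then show ?thesis ..
    next
      case True
      obtain J s where w: "w = (J, s)"
        by (cases w)
      obtain y where y: "\<And>l. l < m \<Longrightarrow> agrees m \<theta> (bits s) (J l) (y (J l))"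
          "\<And>j. j < m \<Longrightarrow> real (card {l. l < m \<and> s j ! J l \<noteq> y (J l)}) \<le> \<tau> * m"
        using ok by (auto simp: matrix_ok_def w)
      show ?thesis
      proof (cases "\<forall>l<m. y (J l) = x ! J l")
        case eq: True
        have "real (card {l. l < m \<and> J l \<in> {i. s j ! i \<noteq> x ! i}}) \<le> \<tau> * m" if "j < m" for j
          using y(2)[OF that] eq by (simp cong: conj_cong)
        with True show ?thesis
          by (simp add: w)
      next
        case False
        then obtain l where l: "l < m" "y (J l) = (\<not> x ! J l)"
          by blast
        have "?F J s"
          using y(1)[OF l(1)] l by (intro bexI[of _ l]) simp_all
        then show ?thesis
          by (simp add: w)
      qed
    qed
  qed
  also have "\<dots> \<le> measure_pmf.prob ?V {w. ?E (snd w)} + (measure_pmf.prob ?V {w. ?F (fst w) (snd w)}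
      + measure_pmf.prob ?V {w. ?G (fst w) (snd w)})"
    by (intro order_trans[OF prob_disj_le] add_left_mono prob_disj_le)
  also have "measure_pmf.prob ?V {w. ?E (snd w)} \<le> exp (- (2 * \<rho>\<^sup>2 * m))"
    by (rule prob_pair_pmf_le[where R = "\<lambda>J s. ?E s"], rule Pi_pmf_count_le) (use bad assms(3,6) in auto)
  also have "measure_pmf.prob ?V {w. ?F (fst w) (snd w)} \<le> card {..<m} * e"
  proof (intro prob_pair_pmf_le prob_bex_le)
    fix J l assume "J \<in> set_pmf (coords m n)" "l \<in> {..<m}"
    then have "measure_pmf.prob P {v. v ! J l \<noteq> x ! J l} \<le> 1/2"
      using set_coords assms(2) half by blast
    then have "\<theta> + \<alpha> \<le> measure_pmf.prob P {v. v ! J l \<noteq> (\<not> x ! J l)}"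
      using assms(5) unfolding prob_neq_Not by linarith
    then show "measure_pmf.prob (samples N P) {s. agrees m \<theta> (bits s) (J l) (\<not> x ! J l)} \<le> e"
      unfolding e_def by (intro prob_agrees_le assms)
  qed simp
  also have "measure_pmf.prob ?V {w. ?G (fst w) (snd w)} \<le> e"
  proof (rule prob_pair_pmf_le')
    fix s
    show "measure_pmf.prob (coords m n) {J. ?G J s} \<le> e"
    proof (cases "\<exists>j<m. s j \<in> ?B")
      case True
      then obtain j where j: "j < m" "\<tau> + \<alpha> \<le> card {i. i < n \<and> s j ! i \<noteq> x ! i} / n"
        by blast
      \<comment> \<open>The far row \<open>j\<close> depends only on the fixed samples, so a single
        estimate replaces a sum over rows.\<close>
      have "measure_pmf.prob (coords m n) {J. ?G J s} \<le>
          measure_pmf.prob (coords m n) {J. real (card {l. l < m \<and> J l \<in> {i. s j ! i \<noteq> x ! i}}) \<le> \<tau> * m}"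
        by (rule prob_mono_on_support) (use j(1) in blast)
      also have "\<dots> \<le> e"
        unfolding e_def
        by (intro Pi_pmf_count_le order_refl assms(4)) (use j(2) in \<open>unfold prob_coord[OF assms(2)]\<close>)
      finally show ?thesis .
    next
      case False
      then have "{J. ?G J s} = {}"
        by blast
      then show ?thesis
        by (simp only: measure_empty) (simp add: e_def)
    qed
  qed
  finally show ?thesis
    by simp
qed

section \<open>The tester\<close>

text \<open>Three runs leave an error of 7/27, hence room for 4/54 from all other sources.\<close>

definition amplified :: "nat query_tree pmf \<Rightarrow> nat query_tree pmf" where
  "amplified T = map_pmf (\<lambda>(t1, t2, t3). majority_tree t1 t2 t3) (pair_pmf T (pair_pmf T T))"

text \<open>Majority commutes with negation, so one bound serves both verdicts.\<close>

lemma prob_amplified: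
  assumes "measure_pmf.prob T {t. run t f \<noteq> b} \<le> 1/3"
  shows "measure_pmf.prob (amplified T) {t. run t f \<noteq> b} \<le> 7/27"
proof -
  have "(\<lambda>(t1, t2, t3). majority_tree t1 t2 t3) -` {t. run t f \<noteq> b} =
    {(t1, t2, t3). \<not> (run t1 f = b \<and> run t2 f = b \<or> run t1 f = b \<and> run t3 f = b \<or> run t2 f = b \<and> run t3 f = b)}"
    by (cases b) (auto simp: run_majority_tree)
  then show ?thesis
    using prob_majority_of_three[of T "\<lambda>t. run t f = b"] assms by (simp add: amplified_def)
qed

lemma set_amplified:
  assumes "t \<in> set_pmf (amplified T)"
    and "\<And>t. t \<in> set_pmf T \<Longrightarrow> queries t \<subseteq> A" and "\<And>t. t \<in> set_pmf T \<Longrightarrow> query_count t \<le> q"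
  shows "queries t \<subseteq> A" and "query_count t \<le> 3 * q"
proof -
  obtain t1 t2 t3 where t: "t = majority_tree t1 t2 t3"
      and T: "t1 \<in> set_pmf T" "t2 \<in> set_pmf T" "t3 \<in> set_pmf T"
    using assms(1) by (auto simp: amplified_def)
  show "queries t \<subseteq> A"
    unfolding t using queries_majority_tree assms(2)[OF T(1)] assms(2)[OF T(2)] assms(2)[OF T(3)]
    by (metis Un_least subset_trans)
  show "query_count t \<le> 3 * q"
    using query_count_majority_tree[of t1 t2 t3] assms(3)[OF T(1)] assms(3)[OF T(2)] assms(3)[OF T(3)]
    by (simp add: t)
qed

section \<open>Numbers of samples that make the errors small\<close>

lemma exp_minus_le: "0 < x \<Longrightarrow> exp (- x) \<le> 2 / x\<^sup>2" for x :: real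
proof -
  assume x: "0 < x"
  then have "x\<^sup>2 / 2 \<le> exp x"
    using exp_lower_Taylor_quadratic[of x] by linarith
  then show ?thesis
    using x by (simp add: exp_minus field_simps)
qed

text \<open>With \<open>x = 2 * m / u^2\<close>, bounding \<open>exp (- x)\<close> by
  \<open>2 / x^2\<close> leaves \<open>m * 2 / x^2 = u^4 / (2 * m)\<close>, which is
  \<open>1/54\<close> for this \<open>m\<close>.\<close>

lemma matrix_error_le:
  fixes u :: nat and m :: nat
  assumes "0 < u" and "m = 27 * u ^ 4"
  shows "m * exp (- (2 * (1 / real u)\<^sup>2 * m)) \<le> 1/54"
proof -
  have "m * exp (- (2 * (1 / real u)\<^sup>2 * m)) \<le> m * (2 / (2 * (1 / real u)\<^sup>2 * m)\<^sup>2)"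
    by (intro mult_left_mono exp_minus_le) (use assms in auto)
  also have "\<dots> = 1/54"
    using assms(1) by (simp add: assms(2) field_simps power2_eq_square power4_eq_xxxx)
  finally show ?thesis .
qed

text \<open>The factor 9 is \<open>1 + 8\<close>: one \<open>L\<close> pays for \<open>q\<close>, as
  \<open>q + 2 \<le> exp L\<close>, and eight pay for \<open>162 = 3 * 54\<close>, as
  \<open>162 \<le> 2 ^ 8 \<le> exp (8 * L)\<close>.\<close>

lemma emulation_error_le:
  fixes q m :: nat and a :: real
  assumes "0 < a" and "9 / (2 * a\<^sup>2) * log 2 (real q + 2) \<le> m"
  shows "3 * real q * exp (- (2 * a\<^sup>2 * m)) \<le> 1/54"
proof -
  define L where "L = log 2 (real q + 2)"
  have L: "1 \<le> L"
    by (simp add: L_def)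
  have "real q + 2 = exp (ln 2 * L)"
    by (simp add: L_def log_def)
  also have "\<dots> \<le> exp L"
    using L ln_2_less_1 by simp
  finally have q: "real q + 2 \<le> exp L" .
  have "(2::real) \<le> exp 1"
    using exp_ge_add_one_self[of 1] by simp
  then have "(2::real) ^ 8 \<le> exp 1 ^ 8"
    by (rule power_mono) simp
  also have "\<dots> = exp 8"
    by (simp flip: exp_of_nat_mult)
  also have "\<dots> \<le> exp (8 * L)"
    using L by simp
  finally have "162 \<le> exp (8 * L)"
    by simp
  with q have "real q * 162 \<le> exp L * exp (8 * L)"
    by (intro mult_mono) auto
  also have "\<dots> = exp (9 * L)"
    by (simp flip: exp_add)
  also have "\<dots> \<le> exp (2 * a\<^sup>2 * m)"
    using assms by (simp add: L_def field_simps)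
  finally show ?thesis
    by (simp add: exp_minus field_simps)
qed

text \<open>The accuracy is \<open>1 / u\<close>, which is at most \<open>\<epsilon> / 16\<close> and at most half of the gap between
  \<open>\<eta>\<close> and 1/2. The choice \<open>m = 27 u\<^sup>4\<close> makes Hoeffding's bound on a single
  estimate, summed over all rows or columns, at most 1/54.\<close>

locale tester_analysis =
  fixes n m\<^sub>0 m u q N :: nat and \<eta> \<delta> \<epsilon> a :: real
    and T :: "nat query_tree pmf" and S :: "bool list set" and P :: "bool list pmf"
  assumes n: "0 < n" and \<epsilon>: "0 < \<epsilon>" and \<eta>: "0 \<le> \<eta>" and \<delta>: "0 \<le> \<delta>"
    and a: "0 < a" "\<eta> + 2 * a = 1/2"
    and u: "0 < u" "16 / \<epsilon> \<le> u" "1 / a \<le> u"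
    and m: "m = 27 * u ^ 4" and N: "m \<le> N" "m\<^sub>0 \<le> N" and m0: "0 < m\<^sub>0"
    and m0_large: "3 * real q * exp (- (2 * a\<^sup>2 * m\<^sub>0)) \<le> 1/54"
    and T: "\<And>t. t \<in> set_pmf T \<Longrightarrow> queries t \<subseteq> {..<n}" "\<And>t. t \<in> set_pmf T \<Longrightarrow> query_count t \<le> q"
    and T_accept: "\<And>x. x \<in> S \<Longrightarrow> measure_pmf.prob T {t. run t ((!) x) \<noteq> True} \<le> 1/3"
    and T_reject: "\<And>x. x \<in> bitstrings n \<Longrightarrow> (\<forall>z\<in>S. hamming_dist n x z > \<epsilon> / 2) \<Longrightarrow>
      measure_pmf.prob T {t. run t ((!) x) \<noteq> False} \<le> 1/3"
    and P: "P \<in> distributions n"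
begin

definition \<alpha> :: real where "\<alpha> = 1 / u"
text \<open>The thresholds \<open>\<theta>\<close> and \<open>\<tau>\<close> lie
  \<open>\<alpha>\<close> above the values \<open>\<eta>\<close> and \<open>k / n\<close> allowed to
  members of the property, so that an excess of \<open>2 * \<alpha>\<close> is caught with the same
  margin \<open>\<alpha>\<close>.\<close>

definition \<theta> :: real where "\<theta> = \<eta> + \<alpha>"
definition k :: nat where "k = nat \<lfloor>\<delta> * n\<rfloor>"
definition \<tau> :: real where "\<tau> = k / n + \<alpha>"
definition e :: real where "e = exp (- (2 * \<alpha>\<^sup>2 * m))"
definition W :: "((nat query_tree \<times> (nat \<Rightarrow> nat)) \<times> (nat \<Rightarrow> bool list)) pmf" where
  "W = pair_pmf (pair_pmf (amplified T) (coords m n)) (samples N P)"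
definition accepts :: "(nat query_tree \<times> (nat \<Rightarrow> nat)) \<times> (nat \<Rightarrow> bool list) \<Rightarrow> bool" where
  "accepts w \<longleftrightarrow> run (tester_tree m\<^sub>0 (\<eta> + a) m \<theta> \<tau> (fst w)) (bits (snd w))"

lemma accepts_iff:
  "accepts ((t, J), s) \<longleftrightarrow> run (emulate m\<^sub>0 (\<eta> + a) t) (bits s) \<and> matrix_ok m \<theta> \<tau> J (bits s)"
  by (simp add: accepts_def run_tester_tree)

lemma \<alpha>: "0 < \<alpha>" "\<alpha> \<le> \<epsilon> / 16" "\<alpha> \<le> a" "\<theta> + \<alpha> \<le> 1/2"
proof -
  show "0 < \<alpha>"
    using u(1) by (simp add: \<alpha>_def)
  show "\<alpha> \<le> \<epsilon> / 16"
    using u(1,2) \<epsilon> by (simp add: \<alpha>_def field_simps)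
  show "\<alpha> \<le> a"
    using u(1,3) a(1) by (simp add: \<alpha>_def field_simps)
  then show "\<theta> + \<alpha> \<le> 1/2"
    using a(2) by (simp add: \<theta>_def)
qed

lemma e: "m * e \<le> 1/54" "e \<le> m * e"
proof -
  show "m * e \<le> 1/54"
    using matrix_error_le[OF u(1) m] by (simp add: e_def \<alpha>_def)
  have "1 \<le> m"
    using u(1) by (simp add: m)
  then show "e \<le> m * e"
    by (simp add: e_def)
qed

lemma prob_W_coords:
  "measure_pmf.prob W {w. R (snd (fst w)) (snd w)}
    = measure_pmf.prob (pair_pmf (coords m n) (samples N P)) {w. R (fst w) (snd w)}"
proof -
  have "pair_pmf (coords m n) (samples N P) = map_pmf (\<lambda>(p, s). (snd p, s)) W"
    using map_pair[of snd "\<lambda>s. s" "pair_pmf (amplified T) (coords m n)" "samples N P"]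
    by (simp add: W_def map_snd_pair_pmf)
  then show ?thesis
    by (simp add: vimage_def case_prod_beta)
qed

lemma prob_W_tree:
  "measure_pmf.prob W {w. R (fst (fst w)) (snd w)}
    = measure_pmf.prob (pair_pmf (amplified T) (samples N P)) {w. R (fst w) (snd w)}"
proof -
  have "pair_pmf (amplified T) (samples N P) = map_pmf (\<lambda>(p, s). (fst p, s)) W"
    using map_pair[of fst "\<lambda>s. s" "pair_pmf (amplified T) (coords m n)" "samples N P"]
    by (simp add: W_def map_fst_pair_pmf)
  then show ?thesis
    by (simp add: vimage_def case_prod_beta)
qed

lemma prob_W_verdict:
  assumes "measure_pmf.prob T {t. run t f \<noteq> b} \<le> 1/3"
  shows "measure_pmf.prob W {w. run (fst (fst w)) f \<noteq> b} \<le> 7/27"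
  unfolding prob_W_tree[where R = "\<lambda>t s. run t f \<noteq> b"]
  by (rule prob_pair_pmf_le'[where R = "\<lambda>t s. run t f \<noteq> b"]) (rule prob_amplified[OF assms])

lemma completeness:
  assumes z: "z \<in> S" and D: "P \<in> D_per n \<eta> \<delta> z"
  shows "measure_pmf.prob W {w. \<not> accepts w} \<le> 1/3"
proof -
  have marginal: "measure_pmf.prob P {v. v ! i \<noteq> z ! i} \<le> \<eta>" if "i < n" for i
    using D that by (simp add: D_per_def)
  have close: "card {i. i < n \<and> v ! i \<noteq> z ! i} / n \<le> \<tau> - \<alpha>" if "v \<in> set_pmf P" for v
  proof -
    have "measure_pmf.prob P {v. real (card {i. i < n \<and> v ! i \<noteq> z ! i}) \<le> \<delta> * n} = 1"
      using D by (simp add: D_per_def)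
    then have "real (card {i. i < n \<and> v ! i \<noteq> z ! i}) \<le> \<delta> * n"
      using that by (subst (asm) measure_pmf.prob_eq_1) (auto simp: AE_measure_pmf_iff)
    then have "card {i. i < n \<and> v ! i \<noteq> z ! i} \<le> k"
      unfolding k_def by linarith
    then show ?thesis
      by (simp add: \<tau>_def divide_right_mono)
  qed
  let ?A = "\<lambda>w :: (nat query_tree \<times> (nat \<Rightarrow> nat)) \<times> (nat \<Rightarrow> bool list). run (fst (fst w)) ((!) z) \<noteq> True"
  let ?B = "\<lambda>t s. run (emulate m\<^sub>0 (\<eta> + a) t) (bits s) \<noteq> run t ((!) z)"
  let ?C = "\<lambda>J s. \<not> matrix_ok m \<theta> \<tau> J (bits s)"
  have "measure_pmf.prob W {w. \<not> accepts w} \<le>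
      measure_pmf.prob W {w. ?A w \<or> (?B (fst (fst w)) (snd w) \<or> ?C (snd (fst w)) (snd w))}"
    by (rule prob_mono_on_support) (auto simp: accepts_iff)
  also have "\<dots> \<le> measure_pmf.prob W {w. ?A w} +
      (measure_pmf.prob W {w. ?B (fst (fst w)) (snd w)} + measure_pmf.prob W {w. ?C (snd (fst w)) (snd w)})"
    by (intro order_trans[OF prob_disj_le] add_left_mono prob_disj_le)
  also have "measure_pmf.prob W {w. ?A w} \<le> 7/27"
    by (rule prob_W_verdict[OF T_accept[OF z]])
  also have "measure_pmf.prob W {w. ?B (fst (fst w)) (snd w)} \<le> 1/54"
    unfolding prob_W_tree[where R = ?B]
  proof (rule prob_pair_pmf_le)
    fix t assume t: "t \<in> set_pmf (amplified T)"
    note set = set_amplified[OF t T]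
    have "measure_pmf.prob (samples N P) {s. ?B t s} \<le> (3 * q) * exp (- (2 * a\<^sup>2 * m\<^sub>0))"
    proof (rule prob_run_emulate_neq[OF N(2) m0 _ _ _ set(2)])
      fix i assume "i \<in> queries t"
      then have "i < n"
        using set(1) by blast
      \<comment> \<open>The emulation threshold \<open>\<eta> + a\<close> lies midway between
        \<open>\<eta>\<close> and 1/2, so \<open>a\<close> is the margin both here and in
        \<open>soundness\<close>.\<close>
      then show "measure_pmf.prob P {v. v ! i \<noteq> z ! i} \<le> \<eta> + a - a"
        unfolding add_diff_cancel_right' by (rule marginal)
    qed (use a in auto)
    with m0_large show "measure_pmf.prob (samples N P) {s. ?B t s} \<le> 1/54"
      by simp
  qed
  also have "measure_pmf.prob W {w. ?C (snd (fst w)) (snd w)} \<le> 2 * (m * e)"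
    unfolding prob_W_coords[where R = ?C] e_def
    by (rule prob_not_matrix_ok_le[where z = z])
      (use n N \<alpha> marginal close in \<open>auto simp: \<theta>_def\<close>)
  \<comment> \<open>The total is at most 7/27 + 1/54 + 2/54 = 17/54.\<close>
  finally show ?thesis
    using e(1) by simp
qed

lemma soundness:
  assumes far: "\<And>z P'. z \<in> S \<Longrightarrow> P' \<in> D_per n \<eta> \<delta> z \<Longrightarrow> emd n P P' > \<epsilon>"
  shows "measure_pmf.prob W {w. accepts w} \<le> 1/3"
proof -
  \<comment> \<open>The majority string. Ties go to \<open>True\<close>, where the opposite bit has
    probability exactly 1/2.\<close>
  define x where "x = map (\<lambda>i. 1/2 \<le> measure_pmf.prob P {v. v ! i}) [0..<n]"
  define p where "p = (\<lambda>i. measure_pmf.prob P {v. v ! i \<noteq> x ! i})"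
  define d where "d = (\<lambda>v. card {i. i < n \<and> v ! i \<noteq> x ! i})"
  have x: "x \<in> bitstrings n"
    by (simp add: x_def bitstrings_def)
  have half: "measure_pmf.prob P {v. v ! i \<noteq> x ! i} \<le> 1/2" if "i < n" for i
    using that prob_Not[of P "\<lambda>v. v ! i"] by (cases "x ! i") (auto simp: x_def)
  let ?C = "\<lambda>J s. matrix_ok m \<theta> \<tau> J (bits s)"
  have matrix: "measure_pmf.prob W {w. accepts w}
      \<le> measure_pmf.prob (pair_pmf (coords m n) (samples N P)) {w. ?C (fst w) (snd w)}"
    unfolding prob_W_coords[where R = ?C, symmetric] by (rule prob_mono_on_support) (auto simp: accepts_iff)
  \<comment> \<open>As \<open>\<epsilon> / 8\<close> is at least \<open>2 * \<alpha>\<close>, the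
    probability of missing a bad set of mass \<open>\<epsilon> / 8\<close> is absorbed into
    \<open>e\<close>.\<close>
  have \<rho>: "exp (- (2 * (\<epsilon> / 8)\<^sup>2 * m)) \<le> e"
  proof -
    have "\<alpha>\<^sup>2 \<le> (\<epsilon> / 8)\<^sup>2"
      using \<alpha> by (intro power_mono) auto
    then show ?thesis
      by (simp add: e_def mult_right_mono)
  qed
  consider
      "\<forall>z\<in>S. hamming_dist n x z > \<epsilon> / 2"
    | "\<epsilon> / 4 < (\<Sum>i<n. max 0 (p i - \<eta>)) / n"
    | "\<epsilon> / 4 < measure_pmf.expectation P (\<lambda>v. real (d v - k) / n)"
  proof (cases "\<forall>z\<in>S. hamming_dist n x z > \<epsilon> / 2")
    case False
    then obtain z where z: "z \<in> S" "hamming_dist n x z \<le> \<epsilon> / 2"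
      by force
    obtain P' where "P' \<in> D_per n \<eta> \<delta> z" and le: "emd n P P' \<le> hamming_dist n x z
        + (\<Sum>i<n. max 0 (p i - \<eta>)) / n + measure_pmf.expectation P (\<lambda>v. real (d v - k) / n)"
      using emd_D_per_le[OF n P \<eta> \<delta>, of z x] unfolding p_def d_def k_def by blast
    then have "\<epsilon> < emd n P P'"
      using far[OF z(1)] by blast
    with le z(2) have
      "\<epsilon> / 2 < (\<Sum>i<n. max 0 (p i - \<eta>)) / n + measure_pmf.expectation P (\<lambda>v. real (d v - k) / n)"
      by linarith
    then show ?thesis
      using that(2,3) by linarith
  qed (rule that(1))
  then show ?thesis
  proof cases
    case 1
    let ?A = "\<lambda>w :: (nat query_tree \<times> (nat \<Rightarrow> nat)) \<times> (nat \<Rightarrow> bool list). run (fst (fst w)) ((!) x) \<noteq> False"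
    let ?B = "\<lambda>t s. run (emulate m\<^sub>0 (\<eta> + a) t) (bits s) \<and> \<not> run t ((!) x)"
    have "measure_pmf.prob W {w. accepts w} \<le> measure_pmf.prob W {w. ?A w \<or> ?B (fst (fst w)) (snd w)}"
      by (rule prob_mono_on_support) (auto simp: accepts_iff)
    also have "\<dots> \<le> measure_pmf.prob W {w. ?A w} + measure_pmf.prob W {w. ?B (fst (fst w)) (snd w)}"
      by (rule prob_disj_le)
    also have "measure_pmf.prob W {w. ?A w} \<le> 7/27"
      by (rule prob_W_verdict[OF T_reject[OF x 1]])
    also have "measure_pmf.prob W {w. ?B (fst (fst w)) (snd w)} \<le> 1/54"
      unfolding prob_W_tree[where R = ?B]
    proof (rule prob_pair_pmf_le)
      fix t assume t: "t \<in> set_pmf (amplified T)"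
      note set = set_amplified[OF t T]
      have "measure_pmf.prob (samples N P) {s. ?B t s} \<le> (3 * q) * exp (- (2 * a\<^sup>2 * m\<^sub>0))"
      proof (rule prob_run_emulate_and_not_run[OF N(2) _ _ _ set(2)])
        fix i assume "i \<in> queries t"
        with set(1) show "measure_pmf.prob P {v. v ! i \<noteq> x ! i} \<le> 1/2"
          by (intro half) auto
      qed (use a in auto)
      with m0_large show "measure_pmf.prob (samples N P) {s. ?B t s} \<le> 1/54"
        by simp
    qed
    finally show ?thesis
      by simp
  next
    case 2
    have "\<epsilon> / 4 < measure_pmf.expectation (pmf_of_set {..<n}) (\<lambda>i. max 0 (p i - \<eta>))"
      using 2 n by (subst integral_pmf_of_set) auto
    \<comment> \<open>Half of the mean excess is conceded to positions of small excess. Hence at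
      least an \<open>\<epsilon> / 8\<close> fraction of positions has excess at least
      \<open>\<epsilon> / 8\<close>, and so at least \<open>2 * \<alpha>\<close>.\<close>
    also have "\<dots> \<le> measure_pmf.prob (pmf_of_set {..<n}) {i. \<epsilon> / 8 \<le> max 0 (p i - \<eta>)} + \<epsilon> / 8"
    proof (rule expectation_le_prob_ge)
      fix i
      have "p i \<le> 1"
        unfolding p_def by (rule measure_pmf.prob_le_1)
      then show "max 0 (p i - \<eta>) \<le> 1"
        using \<eta> by simp
    qed (use \<epsilon> in auto)
    also have "measure_pmf.prob (pmf_of_set {..<n}) {i. \<epsilon> / 8 \<le> max 0 (p i - \<eta>)}
        \<le> measure_pmf.prob (pmf_of_set {..<n}) {i. \<theta> + \<alpha> \<le> p i}"
    proof (rule prob_mono_on_support)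
      fix i assume "\<epsilon> / 8 \<le> max 0 (p i - \<eta>)"
      then show "\<theta> + \<alpha> \<le> p i"
        using \<epsilon> \<alpha>(2) by (simp add: \<theta>_def max_def split: if_splits)
    qed
    finally have "\<epsilon> / 8 \<le> measure_pmf.prob (pmf_of_set {..<n}) {i. \<theta> + \<alpha> \<le> measure_pmf.prob P {v. v ! i \<noteq> x ! i}}"
      by (simp add: p_def)
    then have "measure_pmf.prob (pair_pmf (coords m n) (samples N P)) {w. ?C (fst w) (snd w)}
        \<le> exp (- (2 * (\<epsilon> / 8)\<^sup>2 * m)) + 2 * e"
      unfolding e_def
      by (intro prob_matrix_ok_le_if_marginals[where x = x]) (use n N \<alpha> \<epsilon> half in auto)
    \<comment> \<open>The matrix test alone rejects: the error is at most \<open>3 * e\<close>,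
      hence at most 3/54.\<close>
    with matrix \<rho> e show ?thesis
      by linarith
  next
    case 3
    have d: "d v \<le> n" for v
      using card_mono[of "{..<n}" "{i. i < n \<and> v ! i \<noteq> x ! i}"] by (auto simp: d_def)
    note 3
    also have "measure_pmf.expectation P (\<lambda>v. real (d v - k) / n)
        \<le> measure_pmf.prob P {v. \<epsilon> / 8 \<le> real (d v - k) / n} + \<epsilon> / 8"
    proof (rule expectation_le_prob_ge)
      fix v
      have "d v - k \<le> n"
        using d[of v] by simp
      then show "real (d v - k) / n \<le> 1"
        using n by simp
    qed (use \<epsilon> in auto)
    also have "measure_pmf.prob P {v. \<epsilon> / 8 \<le> real (d v - k) / n}
        \<le> measure_pmf.prob P {v. \<tau> + \<alpha> \<le> d v / n}"
    proof (rule prob_mono_on_support)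
      fix v assume v: "\<epsilon> / 8 \<le> real (d v - k) / n"
      then have "0 < real (d v - k) / n"
        using \<epsilon> by linarith
      \<comment> \<open>Positivity rules out truncation, so the natural difference is the real
        one.\<close>
      then have "k < d v"
        by (cases "k < d v") auto
      then have "real (d v - k) / n = d v / n - k / n"
        by (simp add: of_nat_diff diff_divide_distrib)
      then show "\<tau> + \<alpha> \<le> d v / n"
        using v \<alpha>(2) unfolding \<tau>_def by linarith
    qed
    finally have "\<epsilon> / 8 \<le> measure_pmf.prob P {v. \<tau> + \<alpha> \<le> card {i. i < n \<and> v ! i \<noteq> x ! i} / n}"
      by (simp add: d_def)
    then have "measure_pmf.prob (pair_pmf (coords m n) (samples N P)) {w. ?C (fst w) (snd w)}
        \<le> exp (- (2 * (\<epsilon> / 8)\<^sup>2 * m)) + (m * e + e)"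
      unfolding e_def
      by (intro prob_matrix_ok_le_if_distances[where x = x]) (use n N \<alpha> \<epsilon> half in auto)
    with matrix \<rho> e show ?thesis
      by linarith
  qed
qed

definition tester :: "(nat \<times> nat) query_tree pmf" where
  "tester = map_pmf (tester_tree m\<^sub>0 (\<eta> + a) m \<theta> \<tau>) (pair_pmf (amplified T) (coords m n))"

lemma doho_verdict_tester: "doho_verdict tester P = map_pmf accepts W"
proof -
  have "fst ` queries (tester_tree m\<^sub>0 (\<eta> + a) m \<theta> \<tau> p) \<subseteq> {..<N}" for p
    using queries_tester_tree[of m\<^sub>0 "\<eta> + a" m \<theta> \<tau> "fst p" "snd p"] N by fastforce
  then have "doho_verdict tester P = map_pmf (\<lambda>(t, s). run t (bits s)) (pair_pmf tester (samples N P))"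
    by (intro doho_verdict_eq) (auto simp: tester_def)
  also have "\<dots> = map_pmf accepts W"
    by (simp add: tester_def W_def pair_map_pmf1 pmf.map_comp accepts_def[abs_def] o_def apfst_def map_prod_def split_beta')
  finally show ?thesis .
qed

lemma tester_accepts:
  assumes "z \<in> S" "P \<in> D_per n \<eta> \<delta> z"
  shows "2/3 \<le> pmf (doho_verdict tester P) True"
  using completeness[OF assms] by (simp add: doho_verdict_tester pmf_map vimage_def prob_Not)

lemma tester_rejects:
  assumes "\<And>z P'. z \<in> S \<Longrightarrow> P' \<in> D_per n \<eta> \<delta> z \<Longrightarrow> emd n P P' > \<epsilon>"
  shows "2/3 \<le> pmf (doho_verdict tester P) False"
  using soundness[OF assms] by (simp add: doho_verdict_tester pmf_map vimage_def prob_Not)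

lemma tester_queries:
  assumes "t \<in> set_pmf tester"
  shows "queries t \<subseteq> UNIV \<times> {..<n}" and "query_count t \<le> 3 * q * m\<^sub>0 + m * m"
proof -
  obtain t' J where t: "t = tester_tree m\<^sub>0 (\<eta> + a) m \<theta> \<tau> (t', J)"
      and t': "t' \<in> set_pmf (amplified T)" and J: "J \<in> set_pmf (coords m n)"
    using assms by (auto simp: tester_def)
  note set = set_amplified[OF t' T]
  show "queries t \<subseteq> UNIV \<times> {..<n}"
    using queries_tester_tree[of m\<^sub>0 "\<eta> + a" m \<theta> \<tau> t' J] set(1) set_coords[OF n J]
    unfolding t by blast
  show "query_count t \<le> 3 * q * m\<^sub>0 + m * m"
    unfolding t using query_count_tester_tree[of m\<^sub>0 "\<eta> + a" m \<theta> \<tau> t' J] mult_le_mono1[OF set(2), of m\<^sub>0]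
    by linarith
qed

end

section \<open>Instantiation of the parameters and the query complexity\<close>

theorem theorem4p2:
  fixes \<eta> \<delta> :: real
  assumes "0 \<le> \<eta>" and "\<eta> < 1/2" and "0 \<le> \<delta>" and "\<delta> \<le> 1"
  shows "\<exists>(p :: real poly) (C :: real) (c :: nat).
           \<forall>(S :: nat \<Rightarrow> bool list set) (Q :: nat \<Rightarrow> real \<Rightarrow> nat).
             (\<forall>n. S n \<subseteq> bitstrings n) \<longrightarrow> string_testable S Q \<longrightarrow>
             (\<exists>q :: nat \<Rightarrow> real \<Rightarrow> nat.
                doho_testable (D_per_prop S \<eta> \<delta>) q \<and>
                (\<forall>n > 0. \<forall>\<epsilon> > 0.
                   real (q n \<epsilon>) \<le> poly p (1 / \<epsilon>) +
                     C * real (Q n (\<epsilon> / 2)) * (log 2 (real (Q n (\<epsilon> / 2)) + 2)) ^ c))"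
proof -
  define a where "a = (1/2 - \<eta>) / 2"
  define c0 where "c0 = 9 / (2 * a\<^sup>2)"
  \<comment> \<open>The linear factor is \<open>16 * X + (1 / a + 1)\<close>, an upper bound for
    \<open>u\<close> at \<open>X = 1 / \<epsilon>\<close>; raised to the power 8 and scaled by
    \<open>729 = 27^2\<close> it bounds \<open>m * m = 729 * u^8\<close>.\<close>
  define p where "p = smult 729 ([:1 / a + 1, 16:] ^ 8)"
  have a: "0 < a" "\<eta> + 2 * a = 1/2"
    using assms(2) by (simp_all add: a_def field_simps)
  have c0: "0 < c0"
    using a(1) by (simp add: c0_def)
  show ?thesis
  \<comment> \<open>The 3 comes from amplification and \<open>c0 + 1\<close> from rounding
    \<open>c0 * L\<close> up, using \<open>1 \<le> L\<close>. A single logarithmic factor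
    suffices.\<close>
  proof (intro exI[of _ p] exI[of _ "3 * (c0 + 1)"] exI[of _ "1::nat"] allI impI)
    fix S :: "nat \<Rightarrow> bool list set" and Q :: "nat \<Rightarrow> real \<Rightarrow> nat"
    assume S: "\<forall>n. S n \<subseteq> bitstrings n" and "string_testable S Q"
    then obtain T where T: "string_tester S Q T"
      by (auto simp: string_testable_def)
    \<comment> \<open>A sum instead of a maximum meets both lower bounds on \<open>u\<close> and
      stays polynomial in \<open>1 / \<epsilon>\<close>.\<close>
    define u where "u = (\<lambda>\<epsilon>. nat \<lceil>16 / \<epsilon> + 1 / a\<rceil>)"
    define m where "m = (\<lambda>\<epsilon>. 27 * u \<epsilon> ^ 4)"
    define L where "L = (\<lambda>n \<epsilon>. log 2 (real (Q n (\<epsilon> / 2)) + 2))"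
    define m\<^sub>0 where "m\<^sub>0 = (\<lambda>n \<epsilon>. nat \<lceil>c0 * L n \<epsilon>\<rceil>)"
    define q where "q = (\<lambda>n \<epsilon>. 3 * Q n (\<epsilon> / 2) * m\<^sub>0 n \<epsilon> + m \<epsilon> * m \<epsilon>)"
    \<comment> \<open>Neither the unknown distribution nor the property is an argument here, so one
      tester serves all distributions.\<close>
    define D where "D = (\<lambda>n \<epsilon>. tester_analysis.tester n (m\<^sub>0 n \<epsilon>) (m \<epsilon>) (u \<epsilon>) \<eta> \<delta> a (T n (\<epsilon> / 2)))"
    have L: "1 \<le> L n \<epsilon>" for n \<epsilon>
      by (simp add: L_def)
    have u: "16 / \<epsilon> + 1 / a \<le> u \<epsilon>" "u \<epsilon> \<le> 16 / \<epsilon> + (1 / a + 1)" if "0 < \<epsilon>" for \<epsilon>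
    proof -
      have "0 < 16 / \<epsilon> + 1 / a"
        using that a(1) by (simp add: add_pos_pos)
      then show "16 / \<epsilon> + 1 / a \<le> u \<epsilon>" "u \<epsilon> \<le> 16 / \<epsilon> + (1 / a + 1)"
        unfolding u_def by linarith+
    qed
    have m0: "c0 * L n \<epsilon> \<le> m\<^sub>0 n \<epsilon>" "m\<^sub>0 n \<epsilon> \<le> (c0 + 1) * L n \<epsilon>" "0 < m\<^sub>0 n \<epsilon>" for n \<epsilon>
    proof -
      have "0 < c0 * L n \<epsilon>"
        using c0 L[of n \<epsilon>] by simp
      then show "c0 * L n \<epsilon> \<le> m\<^sub>0 n \<epsilon>" "m\<^sub>0 n \<epsilon> \<le> (c0 + 1) * L n \<epsilon>" "0 < m\<^sub>0 n \<epsilon>"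
        using L[of n \<epsilon>] unfolding m\<^sub>0_def distrib_right by linarith+
    qed
    have analysis: "tester_analysis n (m\<^sub>0 n \<epsilon>) (m \<epsilon>) (u \<epsilon>) (Q n (\<epsilon> / 2)) (max (m \<epsilon>) (m\<^sub>0 n \<epsilon>))
        \<eta> \<delta> \<epsilon> a (T n (\<epsilon> / 2)) (S n) P"
      if n: "0 < n" and \<epsilon>: "0 < \<epsilon>" and P: "P \<in> distributions n" for n \<epsilon> P
    proof
      have pos: "0 < 16 / \<epsilon>" "0 < 1 / a"
        using \<epsilon> a(1) by auto
      show "16 / \<epsilon> \<le> u \<epsilon>" "1 / a \<le> u \<epsilon>" "0 < u \<epsilon>"
        using u(1)[OF \<epsilon>] pos by linarith+
      show "3 * real (Q n (\<epsilon> / 2)) * exp (- (2 * a\<^sup>2 * m\<^sub>0 n \<epsilon>)) \<le> 1/54"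
        by (rule emulation_error_le[OF a(1)]) (use m0(1)[of n \<epsilon>] in \<open>simp add: c0_def L_def\<close>)
      have \<epsilon>2: "0 < \<epsilon> / 2"
        using \<epsilon> by simp
      note T' = T[unfolded string_tester_def, rule_format, OF n \<epsilon>2]
      show "queries t \<subseteq> {..<n}" "query_count t \<le> Q n (\<epsilon> / 2)" if "t \<in> set_pmf (T n (\<epsilon> / 2))" for t
        using T' that by blast+
      show "measure_pmf.prob (T n (\<epsilon> / 2)) {t. run t ((!) x) \<noteq> True} \<le> 1/3" if "x \<in> S n" for x
      proof -
        have "2/3 \<le> pmf (string_verdict (T n (\<epsilon> / 2)) x) True"
          using T' that S by blast
        then show ?thesis
          by (simp add: string_verdict_def pmf_map vimage_def prob_Not)
      qed
      show "measure_pmf.prob (T n (\<epsilon> / 2)) {t. run t ((!) x) \<noteq> False} \<le> 1/3"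
        if "x \<in> bitstrings n" "\<forall>z\<in>S n. hamming_dist n x z > \<epsilon> / 2" for x
      proof -
        have "2/3 \<le> pmf (string_verdict (T n (\<epsilon> / 2)) x) False"
          using T' that by blast
        then show ?thesis
          by (simp add: string_verdict_def pmf_map vimage_def prob_Not)
      qed
    qed (use n \<epsilon> P a assms m0 in \<open>auto simp: m_def\<close>)
    have "doho_tester (D_per_prop S \<eta> \<delta>) q D"
      unfolding doho_tester_def
    proof (intro allI impI conjI ballI)
      fix n \<epsilon> t assume n: "0 < n" and \<epsilon>: "0 < (\<epsilon> :: real)" and t: "t \<in> set_pmf (D n \<epsilon>)"
      \<comment> \<open>A point mass instantiates the distribution that the locale fixes; the query
        bounds speak only of the tester.\<close>
      have "return_pmf (replicate n False) \<in> distributions n"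
        by (simp add: distributions_def bitstrings_def)
      from tester_analysis.tester_queries[OF analysis[OF n \<epsilon> this]] t
      show "queries t \<subseteq> UNIV \<times> {..<n}" "query_count t \<le> q n \<epsilon>"
        unfolding D_def q_def by blast+
    next
      fix n \<epsilon> P assume n: "0 < n" and \<epsilon>: "0 < (\<epsilon> :: real)" and P: "P \<in> distributions n"
        and "P \<in> D_per_prop S \<eta> \<delta> n"
      then show "2/3 \<le> pmf (doho_verdict (D n \<epsilon>) P) True"
        using tester_analysis.tester_accepts[OF analysis[OF n \<epsilon> P]] unfolding D_def D_per_prop_def by blast
    next
      fix n \<epsilon> P assume n: "0 < n" and \<epsilon>: "0 < (\<epsilon> :: real)" and P: "P \<in> distributions n"
        and "\<forall>P'\<in>D_per_prop S \<eta> \<delta> n. \<epsilon> < emd n P P'"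
      then show "2/3 \<le> pmf (doho_verdict (D n \<epsilon>) P) False"
        unfolding D_def D_per_prop_def by (intro tester_analysis.tester_rejects[OF analysis[OF n \<epsilon> P]]) blast
    qed
    moreover have "real (q n \<epsilon>) \<le> poly p (1 / \<epsilon>) + 3 * (c0 + 1) * real (Q n (\<epsilon> / 2)) * L n \<epsilon> ^ 1"
      if "0 < \<epsilon>" for n \<epsilon>
    proof -
      have "real (m \<epsilon> * m \<epsilon>) = 729 * real (u \<epsilon>) ^ 8"
        by (simp add: m_def flip: power_add)
      also have "\<dots> \<le> 729 * (16 / \<epsilon> + (1 / a + 1)) ^ 8"
        by (intro mult_left_mono power_mono u(2)[OF that]) auto
      also have "\<dots> = poly p (1 / \<epsilon>)"
        by (simp add: p_def add_ac)
      finally have "real (m \<epsilon> * m \<epsilon>) \<le> poly p (1 / \<epsilon>)" .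
      moreover have "3 * real (Q n (\<epsilon> / 2)) * m\<^sub>0 n \<epsilon> \<le> 3 * real (Q n (\<epsilon> / 2)) * ((c0 + 1) * L n \<epsilon>)"
        by (intro mult_left_mono m0(2)) simp
      ultimately show ?thesis
        by (simp add: q_def algebra_simps)
    qed
    ultimately show "\<exists>q. doho_testable (D_per_prop S \<eta> \<delta>) q \<and>
        (\<forall>n > 0. \<forall>\<epsilon> > 0. real (q n \<epsilon>) \<le> poly p (1 / \<epsilon>) +
          3 * (c0 + 1) * real (Q n (\<epsilon> / 2)) * (log 2 (real (Q n (\<epsilon> / 2)) + 2)) ^ 1)"
      unfolding doho_testable_def L_def by blast
  qed
qed

end
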